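(* Let $\eta\in(0,1)$ and $q\in(0,1)$, let $\mu=\eta/q$, and let $(a_n,n\in\mathbb{N}^* )$ be a sequence of elements of $\mathbb{N}^*$. For $n\ge 1$ let $\tau_n$ be a random tree distributed as the Galton-Watson tree $\tau$ with offspring distribution $\mathcal{G}(\eta,q)$ conditionally on $\{Z_n=a_n\}$. Assume that $\lim_{n\to\infty}a_n\mu^n=0$ if $\mu<1$, or $\lim_{n\to\infty}a_nn^{-2}=0$ if $\mu=1$, or $\lim_{n\to\infty}a_n\mu^{-n}=0$ if $\mu>1$. Then $\tau_n$ converges in distribution to the Kesten tree $\tau^0$ as $n\to\infty$.
   Context: Notation: $\mathbb{N}=\{0,1,2,\ldots\}$, $\mathbb{N}^*=\{1,2,\ldots\}$, $\bar{\mathbb{N}}=\mathbb{N}\cup\{+\infty\}$. Trees. Let $\mathcal{U}=\bigcup_{n\ge0}(\mathbb{N}^* )^n$ be the set of finite words, with $(\mathbb{N}^* )^0=\{\emptyset\}$; $|u|$ is the length of $u$. A tree is a subset $\mathbf{t}\subset\mathcal{U}$ containing $\emptyset$ (the root), containing with each $u$ all its prefixes (ancestors), and such that for every $u\in\mathbf{t}$ there is $k_u(\mathbf{t})\in\bar{\mathbb{N}}$ (the number of children of $u$) with $ui\in\mathbf{t}\iff 1\le i\le k_u(\mathbf{t})$ for every $i\in\mathbb{N}^*$. Put $k_u(\mathbf{t})=-1$ if $u\notin\mathbf{t}$. $\mathbb{T}_\infty$ is the set of all trees, with the topology in which $\mathbf{t}_n\to\mathbf{t}$ iff $k_u(\mathbf{t}_n)\to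 k_u(\mathbf{t})$ for all $u\in\mathcal{U}$, where $\{-1\}\cup\bar{\mathbb{N}}$ is the one-point compactification of the discrete space $\{-1\}\cup\mathbb{N}$. Convergence in distribution of random trees is weak convergence in $\mathbb{T}_\infty$. $\mathbb{T}_{\rm f}$ is the set of trees with all $k_u(\mathbf{t})<\infty$, $u\in\mathbf{t}$. The height is $H(\mathbf{t})=\sup\{|u|:u\in\mathbf{t}\}$, $z_n(\mathbf{t})=\#\{u\in\mathbf{t}:|u|=n\}$, and $r_h(\mathbf{t})=\{u\in\mathbf{t}:|u|\le h\}$. Offspring distribution. $\mathcal{G}(\eta,q)$ is the distribution $p$ on $\mathbb{N}$ with $p(0)=1-\eta$ and $p(k)=\eta q(1-q)^{k-1}$ for $k\ge1$. Its mean is $\mu=\eta/q$. Put $\kappa=\frac{1-\eta}{1-q}$. Galton-Watson tree. $\tau$ is a $\mathbb{T}_{\rm f}$-valued random variable with $\mathbb{P}(r_h(\tau)=\mathbf{t})=\prod_{u\in r_{h-1}(\mathbf{t})}p(k_u(\mathbf{t}))$ for all $h\ge1$ and $\mathbf{t}\in\mathbb{T}_{\rm f}$ with $H(\mathbf{t})\le h$; $Z_n=z_n(\tau)$. Kesten tree $\tau^0$. Let $\mathfrak{c}=\min(1,\kappa)>0$ (the probability that $H(\tau)<\infty$), let $\mathfrak{p}(n)=\mathfrak{c}^{n-1}p(n)$ for $n\in\mathbb{N}$ (a probability distribution), let $\mathfrak{m}$ be its mean, and let $\mathfrak{p}_{[1]}(n)=n\,\mathfrak{p}(n)/\mathfrak{m}$,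 $n\ge1$, be its size-biased distribution. Consider the two-type Galton-Watson tree, with types $\mathrm{s}$ and $\mathrm{e}$, such that: conditionally on the vertices of lower or same height, the offspring of a vertex depends only on its own type (branching property); the root has type $\mathrm{s}$; a vertex of type $\mathrm{e}$ has only children of type $\mathrm{e}$, their number having distribution $\mathfrak{p}$; a vertex of type $\mathrm{s}$ has a number of children with distribution $\mathfrak{p}_{[1]}$, all of type $\mathrm{e}$ except one, chosen uniformly at random, of type $\mathrm{s}$. Then $\tau^0$ is this random tree with the types forgotten. *)

theory Defs
  imports "HOL-Probability.Probability" "HOL-Library.Extended_Nat"
begin

section \<open>Trees\<close>

definition words :: "nat list set" where
  "words = lists {1..}"

definition all_trees :: "nat list set set" where
  "all_trees = {t. t \<subseteq> words \<and> [] \<in> t \<and> (\<forall>u v. u @ v \<in> t \<longrightarrow> u \<in> t) \<and>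
               (\<forall>u\<in>t. \<exists>k::enat. \<forall>i\<ge>1. u @ [i] \<in> t \<longleftrightarrow> enat i \<le> k)}"

definition children :: "nat list set \<Rightarrow> nat list \<Rightarrow> nat set" where
  "children t u = {i. u @ [i] \<in> t}"

text \<open>The number of children, when it is finite.\<close>

definition num_children :: "nat list set \<Rightarrow> nat list \<Rightarrow> nat" where
  "num_children t u = card (children t u)"

text \<open>
  The number \<open>k\<^sub>u(t)\<close> as a point of the one-point compactification of \<open>{-1} \<union> \<nat>\<close>:
  \<^const>\<open>None\<close> is the point at infinity, and \<open>Some (-1)\<close> marks words outside the tree.
\<close>

definition k_val :: "nat list set \<Rightarrow> nat list \<Rightarrow> int option" where
  "k_val t u = (if u \<notin> t then Some (-1)
                else if finite (children t u) then Some (int (num_children t u)) else None)"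

definition k_topology :: "int option topology" where
  "k_topology = Alexandroff_compactification (discrete_topology {-1..})"

text \<open>
  The coarsest topology on the set of all trees making every \<open>t \<mapsto> k_val t u\<close> continuous;
  see \<open>limitin_tree_topology\<close> below for convergence of sequences.
\<close>

definition tree_topology :: "nat list set topology" where
  "tree_topology = pullback_topology all_trees (\<lambda>t. restrict (k_val t) words)
                     (product_topology (\<lambda>_. k_topology) words)"

lemma topspace_tree_topology: "topspace tree_topology = all_trees"
  by (auto simp: tree_topology_def topspace_pullback_topology k_topology_def k_val_def PiE_def
      extensional_def image_iff)

lemma limitin_tree_topology:
  "limitin tree_topology t l sequentially \<longleftrightarrow>
     l \<in> all_trees \<and> (\<forall>\<^sub>F n in sequentially. t n \<in> all_trees) \<and>
     (\<forall>u\<in>words. limitin k_topology (\<lambda>n. k_val (t n) u) (k_val l u) sequentially)"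
proof -
  let ?P = "product_topology (\<lambda>_. k_topology) words"
  let ?g = "\<lambda>t. restrict (k_val t) words"
  have top: "?g s \<in> topspace ?P" for s
    by (auto simp: k_topology_def k_val_def image_iff)
  have "limitin tree_topology t l sequentially \<longleftrightarrow>
      l \<in> all_trees \<and> (\<forall>\<^sub>F n in sequentially. t n \<in> all_trees) \<and> limitin ?P (\<lambda>n. ?g (t n)) (?g l) sequentially"
    (is "?L \<longleftrightarrow> ?R")
  proof
    assume L: ?L
    then have l: "l \<in> all_trees"
      by (simp add: limitin_def topspace_tree_topology)
    have "\<forall>\<^sub>F n in sequentially. t n \<in> topspace tree_topology"
      using L unfolding limitin_def by auto
    moreover have "limitin ?P (?g \<circ> t) (?g l) sequentially"
      using continuous_map_limit[OF continuous_map_pullback[OF continuous_map_id]] L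
      unfolding tree_topology_def by (fastforce simp: comp_def)
    ultimately show ?R
      using l by (simp add: topspace_tree_topology comp_def)
  next
    assume R: ?R
    show ?L
      unfolding limitin_def
    proof (intro conjI allI impI)
      show "l \<in> topspace tree_topology" using R by (simp add: topspace_tree_topology)
      fix U assume "openin tree_topology U \<and> l \<in> U"
      then obtain V where V: "openin ?P V" "U = ?g -` V \<inter> all_trees" "?g l \<in> V"
        unfolding tree_topology_def openin_pullback_topology by auto
      then have "\<forall>\<^sub>F n in sequentially. ?g (t n) \<in> V"
        using R unfolding limitin_def by blast
      with R have "\<forall>\<^sub>F n in sequentially. ?g (t n) \<in> V \<and> t n \<in> all_trees"
        by (auto intro: eventually_conj)
      then show "\<forall>\<^sub>F n in sequentially. t n \<in> U"
        by eventually_elim (auto simp: V)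
    qed
  qed
  also have "limitin ?P (\<lambda>n. ?g (t n)) (?g l) sequentially \<longleftrightarrow>
     (\<forall>u\<in>words. limitin k_topology (\<lambda>n. k_val (t n) u) (k_val l u) sequentially)"
    using top by (simp add: limitin_componentwise)
  finally show ?thesis .
qed

definition tree_borel :: "nat list set measure" where
  "tree_borel = sigma all_trees {U. openin tree_topology U}"

definition finite_branching_trees :: "nat list set set" where
  "finite_branching_trees = {t \<in> all_trees. \<forall>u\<in>t. finite (children t u)}"

definition tree_height :: "nat list set \<Rightarrow> enat" where
  "tree_height t = (SUP u\<in>t. enat (length u))"

definition gen_size :: "nat \<Rightarrow> nat list set \<Rightarrow> nat" where
  "gen_size n t = card {u \<in> t. length u = n}"

definition truncate :: "nat \<Rightarrow> nat list set \<Rightarrow> nat list set" where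
  "truncate h t = {u \<in> t. length u \<le> h}"


section \<open>Random trees and convergence in distribution\<close>

definition random_tree :: "'w measure \<Rightarrow> ('w \<Rightarrow> nat list set) \<Rightarrow> bool" where
  "random_tree M \<tau> \<longleftrightarrow> prob_space M \<and> \<tau> \<in> measurable M tree_borel"

text \<open>The random elements may live on different probability spaces.\<close>

definition conv_in_distribution ::
  "'x topology \<Rightarrow> (nat \<Rightarrow> 'v measure) \<Rightarrow> (nat \<Rightarrow> 'v \<Rightarrow> 'x) \<Rightarrow> 'w measure \<Rightarrow> ('w \<Rightarrow> 'x) \<Rightarrow> bool" where
  "conv_in_distribution X N Y M Z \<longleftrightarrow>
     (\<forall>f :: 'x \<Rightarrow> real. continuous_map X euclideanreal f \<and> bounded (f ` topspace X) \<longrightarrow>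
        (\<lambda>n. \<integral>\<omega>. f (Y n \<omega>) \<partial>N n) \<longlonglongrightarrow> (\<integral>\<omega>. f (Z \<omega>) \<partial>M))"


section \<open>Galton--Watson trees\<close>

definition galton_watson_tree :: "'w measure \<Rightarrow> nat pmf \<Rightarrow> ('w \<Rightarrow> nat list set) \<Rightarrow> bool" where
  "galton_watson_tree M p \<tau> \<longleftrightarrow>
     random_tree M \<tau> \<and> (\<forall>\<omega>\<in>space M. \<tau> \<omega> \<in> finite_branching_trees) \<and>
     (\<forall>h\<ge>1. \<forall>t\<in>finite_branching_trees. tree_height t \<le> enat h \<longrightarrow>
        \<P>(\<omega> in M. truncate h (\<tau> \<omega>) = t) = (\<Prod>u\<in>truncate (h - 1) t. pmf p (num_children t u)))"

definition geo_offspring :: "real \<Rightarrow> real \<Rightarrow> nat pmf" where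
  "geo_offspring \<eta> q = embed_pmf (\<lambda>k. if k = 0 then 1 - \<eta> else \<eta> * q * (1 - q) ^ (k - 1))"


lemma nn_integral_count_space_nat_sums:
  assumes "\<And>k. 0 \<le> f k" "f sums s"
  shows "(\<integral>\<^sup>+k. ennreal (f k) \<partial>count_space (UNIV :: nat set)) = ennreal s"
  using assms
  by (metis nn_integral_count_space_nat suminf_ennreal_eq)

lemma tilted_geo_sums:
  fixes c \<eta> q :: real
  assumes "0 < \<eta>" "\<eta> < 1" "0 < q" "q < 1" and c: "c = 1 \<or> c = min 1 ((1 - \<eta>) / (1 - q))"
  shows "(\<lambda>k. c powi (int k - 1) * (if k = 0 then 1 - \<eta> else \<eta> * q * (1 - q) ^ (k - 1))) sums 1"
proof -
  have c01: "0 < c" "c \<le> 1" using assms by auto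
  have *: "c * (1 - q) < 1"
    using c01 assms by (smt (verit) mult_left_le_one_le)
  have "(\<lambda>k. \<eta> * q * (c * (1 - q)) ^ k) sums (\<eta> * q * (1 / (1 - c * (1 - q))))"
    using * c01 assms by (intro sums_mult geometric_sums) auto
  then have "(\<lambda>k. c powi (int (Suc k) - 1) *
      (if Suc k = 0 then 1 - \<eta> else \<eta> * q * (1 - q) ^ (Suc k - 1))) sums
      (\<eta> * q / (1 - c * (1 - q)))"
    by (simp add: power_mult_distrib mult_ac)
  then have "(\<lambda>k. c powi (int k - 1) * (if k = 0 then 1 - \<eta> else \<eta> * q * (1 - q) ^ (k - 1))) sums
      (\<eta> * q / (1 - c * (1 - q)) + (1 - \<eta>) / c)"
    by (subst (asm) sums_Suc_iff) (simp add: power_int_minus field_simps)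
  moreover have "\<eta> * q / (1 - c * (1 - q)) + (1 - \<eta>) / c = 1"
  proof (cases "c = 1")
    case True
    then show ?thesis using assms by simp
  next
    case False
    with c have "c = (1 - \<eta>) / (1 - q)" by (auto simp: min_def split: if_splits)
    then have "c * (1 - q) = 1 - \<eta>" "(1 - \<eta>) / c = 1 - q" using assms(1-4) by simp_all
    then show ?thesis using \<open>0 < \<eta>\<close> by (simp only: diff_diff_eq2) simp
  qed
  ultimately show ?thesis by simp
qed

lemma pmf_geo_offspring:
  assumes "0 < \<eta>" "\<eta> < 1" "0 < q" "q < 1"
  shows "pmf (geo_offspring \<eta> q) k = (if k = 0 then 1 - \<eta> else \<eta> * q * (1 - q) ^ (k - 1))"
  unfolding geo_offspring_def
  by (subst pmf_embed_pmf)
    (use assms tilted_geo_sums[OF assms, of 1] in \<open>auto simp: nn_integral_count_space_nat_sums[where s = 1]\<close>)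


section \<open>Multitype Galton--Watson trees\<close>

text \<open>
  A typed tree is a partial map on words whose domain is the tree and whose values are the types.
  The list of the types of the children of \<open>u\<close>, in order, encodes both their number and
  their types.
\<close>

definition child_types :: "(nat list \<rightharpoonup> 's) \<Rightarrow> nat list \<Rightarrow> 's list" where
  "child_types T u = map (\<lambda>i. the (T (u @ [i]))) [1..<Suc (num_children (dom T) u)]"

definition truncate_typed :: "nat \<Rightarrow> (nat list \<rightharpoonup> 's) \<Rightarrow> (nat list \<rightharpoonup> 's)" where
  "truncate_typed h T = T |` {u. length u \<le> h}"

text \<open>
  The last clause is the branching property: given the typed tree up to height \<open>h\<close>, the
  offspring of the vertices at height \<open>h\<close> are independent, and that of a vertex of type \<open>s\<close>
  has law \<open>\<xi> s\<close>.  It is multiplied by the probability of the conditioning event.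
\<close>

definition multitype_GW_tree ::
  "'w measure \<Rightarrow> 's \<Rightarrow> ('s \<Rightarrow> 's list pmf) \<Rightarrow> ('w \<Rightarrow> nat list \<rightharpoonup> 's) \<Rightarrow> bool" where
  "multitype_GW_tree M r \<xi> T \<longleftrightarrow>
     prob_space M \<and>
     (\<forall>u. (\<lambda>\<omega>. T \<omega> u) \<in> measurable M (count_space UNIV)) \<and>
     (\<forall>\<omega>\<in>space M. dom (T \<omega>) \<in> finite_branching_trees \<and> T \<omega> [] = Some r) \<and>
     (\<forall>h t xs. dom t \<in> finite_branching_trees \<and> tree_height (dom t) \<le> enat h \<longrightarrow>
        \<P>(\<omega> in M. truncate_typed h (T \<omega>) = t \<and>
                   (\<forall>u\<in>dom t. length u = h \<longrightarrow> child_types (T \<omega>) u = xs u)) =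
        \<P>(\<omega> in M. truncate_typed h (T \<omega>) = t) *
          (\<Prod>u\<in>{u\<in>dom t. length u = h}. pmf (\<xi> (the (t u))) (xs u)))"


section \<open>Kesten trees\<close>

text \<open>The law \<open>n \<mapsto> c\<^bsup>n-1\<^esup> p(n)\<close>.\<close>

definition tilted :: "real \<Rightarrow> nat pmf \<Rightarrow> nat pmf" where
  "tilted c p = embed_pmf (\<lambda>n. c powi (int n - 1) * pmf p n)"

definition size_biased :: "nat pmf \<Rightarrow> nat pmf" where
  "size_biased p = embed_pmf (\<lambda>n. real n * pmf p n / measure_pmf.expectation p real)"

lemma pmf_tilted_geo_offspring:
  assumes "0 < \<eta>" "\<eta> < 1" "0 < q" "q < 1" and "c = min 1 ((1 - \<eta>) / (1 - q))"
  shows "pmf (tilted c (geo_offspring \<eta> q)) k = c powi (int k - 1) * pmf (geo_offspring \<eta> q) k"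
proof -
  have "0 < c" using assms by auto
  then show ?thesis
    unfolding tilted_def
    using tilted_geo_sums[OF assms(1-4), of c] assms
    by (subst pmf_embed_pmf)
      (auto simp: pmf_geo_offspring[OF assms(1-4)] nn_integral_count_space_nat_sums[where s = 1])
qed

lemma pmf_size_biased:
  assumes "integrable (measure_pmf p) real" and "measure_pmf.expectation p real > 0"
  shows "pmf (size_biased p) n = real n * pmf p n / measure_pmf.expectation p real"
proof -
  let ?m = "measure_pmf.expectation p real"
  have "(\<integral>\<^sup>+n. ennreal (real n * pmf p n / ?m) \<partial>count_space UNIV) =
      (\<integral>\<^sup>+n. ennreal (pmf p n) * ennreal (real n / ?m) \<partial>count_space UNIV)"
    using assms by (intro nn_integral_cong) (simp add: ennreal_mult' [symmetric] field_simps)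
  also have "\<dots> = (\<integral>\<^sup>+n. ennreal (real n / ?m) \<partial>measure_pmf p)"
    by (simp add: nn_integral_measure_pmf)
  also have "\<dots> = ennreal (measure_pmf.expectation p (\<lambda>n. real n / ?m))"
    using assms by (intro nn_integral_eq_integral) auto
  also have "\<dots> = 1" using assms by simp
  finally show ?thesis
    unfolding size_biased_def by (subst pmf_embed_pmf) (use assms in auto)
qed

datatype kesten_type = Special | Normal

fun kesten_offspring :: "nat pmf \<Rightarrow> kesten_type \<Rightarrow> kesten_type list pmf" where
  "kesten_offspring p Normal = map_pmf (\<lambda>k. replicate k Normal) p"
| "kesten_offspring p Special =
     bind_pmf (size_biased p) (\<lambda>k.
       map_pmf (\<lambda>i. (replicate k Normal)[i := Special]) (pmf_of_set {..<k}))"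

definition kesten_tree :: "'w measure \<Rightarrow> nat pmf \<Rightarrow> ('w \<Rightarrow> nat list set) \<Rightarrow> bool" where
  "kesten_tree M p \<tau>0 \<longleftrightarrow>
     (\<exists>T. multitype_GW_tree M Special (kesten_offspring p) T \<and> (\<forall>\<omega>\<in>space M. \<tau>0 \<omega> = dom (T \<omega>)))"

end

theory Submission
  imports Defs "HOL-Real_Asymp.Real_Asymp"
begin

text \<open>
  Write \<open>r\<^sub>h\<close> for truncation at height \<open>h\<close> and \<open>z\<^sub>h(t)\<close> for the number of vertices of \<open>t\<close> at height \<open>h\<close>.
  The proof computes, for a fixed finite tree \<open>t\<close> of height at most \<open>h\<close>, the limit of
  \<open>P(r\<^sub>h(\<tau>\<^sub>n) = t)\<close> and recognises in it \<open>P(r\<^sub>h(\<tau>\<^sup>0) = t)\<close>.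

  Convergence of these probabilities is enough (\<open>conv_in_distribution_truncate\<close>): a continuous function
  of a tree is determined up to a small error by a truncation of the tree, and the truncations of
  \<open>\<tau>\<^sup>0\<close> take countably many values whose probabilities add up to one, so that no mass can escape.

  Let \<open>k = z\<^sub>h(t)\<close>. By the branching property (\<open>galton_watson_branching\<close>)
  \<open>P(r\<^sub>h(\<tau>\<^sub>n) = t) = P(r\<^sub>h(\<tau>) = t) P\<^sub>k(Z\<^bsub>n-h\<^esub> = a\<^sub>n) / P\<^sub>1(Z\<^sub>n = a\<^sub>n)\<close>,
  where \<open>P\<^sub>k\<close> refers to the process of generation sizes started from \<open>k\<close> individuals.
  The generating function of a geometric law is linear fractional, and this form is stable under
  composition; hence under \<open>P\<^sub>1\<close> the size \<open>Z\<^sub>n\<close> again has a law \<open>G(\<eta>\<^sub>n, q\<^sub>n)\<close>, with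
  \<open>q\<^sub>n = 1/D\<^sub>n\<close> and \<open>\<eta>\<^sub>n = \<mu>\<^sup>n/D\<^sub>n\<close> for an explicit \<open>D\<^sub>n\<close> (\<open>gw_process_geo_offspring\<close>).
  A sum of \<open>k\<close> independent such variables equals \<open>a\<close> most easily when one of them equals \<open>a\<close> and the
  others vanish, which happens with probability \<open>k (1 - \<eta>\<^sub>n)\<^bsup>k-1\<^esup> G(\<eta>\<^sub>n, q\<^sub>n)(a)\<close>; each further nonzero
  summand costs a factor of order \<open>a \<eta>\<^sub>n q\<^sub>n\<close>. The assumptions on \<open>a\<^sub>n\<close> say in each of the three
  regimes that \<open>a\<^sub>n \<eta>\<^sub>n q\<^sub>n\<close> tends to zero, and this also makes \<open>G(\<eta>\<^sub>n, q\<^sub>n)(a\<^sub>n)\<close> change asymptotically only by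
  a constant factor when \<open>n\<close> is replaced by \<open>n - h\<close>. With \<open>\<cc>\<close> the extinction probability and
  \<open>m = min(\<mu>, 1/\<mu>)\<close> the quotient of the two probabilities tends to \<open>k \<cc>\<^bsup>k-1\<^esup> m\<^bsup>-h\<^esup>\<close>
  (\<open>gw_process_ratio\<close>).

  On the side of the Kesten tree the special vertices form a single spine. In the offspring law of a
  special vertex the size-biasing factor \<open>k\<^sub>u\<close> cancels against the uniform choice among \<open>k\<^sub>u\<close>
  children, so a typed tree with a prescribed spine has probability
  \<open>m\<^bsup>-h\<^esup> \<Prod> \<pp>(k\<^sub>u)\<close> whatever the spine, where \<open>\<pp>\<close> is the tilted law and \<open>m\<close> its mean. There are
  \<open>k\<close> choices for the end of the spine (\<open>kesten_truncate_prob\<close>), and since the numbers \<open>k\<^sub>u - 1\<close> add up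
  to \<open>k - 1\<close>, the tilting contributes \<open>\<cc>\<^bsup>k-1\<^esup>\<close> (\<open>tree_weight_tilted\<close>). This is the same limit.
\<close>

section \<open>Trees, levels and truncations\<close>

definition level :: "nat \<Rightarrow> nat list set \<Rightarrow> nat list set" where
  "level h t = {u \<in> t. length u = h}"

definition trees_upto :: "nat \<Rightarrow> nat list set set" where
  "trees_upto h = {t \<in> finite_branching_trees. \<forall>u\<in>t. length u \<le> h}"

lemma gen_size_eq_card_level: "gen_size h t = card (level h t)"
  by (simp add: gen_size_def level_def)

lemma trees_upto_iff_height:
  "t \<in> trees_upto h \<longleftrightarrow> t \<in> finite_branching_trees \<and> tree_height t \<le> enat h"
  by (auto simp: trees_upto_def tree_height_def SUP_le_iff)

lemma trees_upto_subset: "trees_upto h \<subseteq> finite_branching_trees" "finite_branching_trees \<subseteq> all_trees"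
  by (auto simp: trees_upto_def finite_branching_trees_def)

lemma root_in_tree: "t \<in> all_trees \<Longrightarrow> [] \<in> t"
  by (auto simp: all_trees_def)

lemma parent_in_tree: "t \<in> all_trees \<Longrightarrow> u @ v \<in> t \<Longrightarrow> u \<in> t"
  unfolding all_trees_def by blast

lemma tree_subset_words: "t \<in> all_trees \<Longrightarrow> t \<subseteq> words"
  by (auto simp: all_trees_def)

text \<open>
  The number of children is described in the definition of a tree by an extended natural number;
  finite branching excludes the value \<open>\<infinity>\<close>, for which every positive integer would be a child.
\<close>

lemma children_eq_interval:
  assumes "t \<in> finite_branching_trees" "u \<in> t"
  shows "children t u = {1..num_children t u}"
proof -
  have t: "t \<in> all_trees" and fin: "finite (children t u)"
    using assms by (auto simp: finite_branching_trees_def)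
  from t assms(2) obtain k :: enat where k: "\<And>i. i \<ge> 1 \<Longrightarrow> u @ [i] \<in> t \<longleftrightarrow> enat i \<le> k"
    unfolding all_trees_def by blast
  have pos: "i \<ge> 1" if "u @ [i] \<in> t" for i
    using that tree_subset_words[OF t] by (auto simp: words_def)
  have eq: "children t u = {i. 1 \<le> i \<and> enat i \<le> k}"
    using k pos by (auto simp: children_def)
  show ?thesis
  proof (cases k)
    case (enat n)
    then have "children t u = {1..n}" by (auto simp: eq)
    then show ?thesis by (simp add: num_children_def)
  next
    case infinity
    then have "{1..} \<subseteq> children t u" by (auto simp: eq)
    then show ?thesis using fin finite_subset infinite_Ici by blast
  qed
qed

lemma child_in_tree_iff:
  assumes "t \<in> finite_branching_trees"
  shows "u @ [i] \<in> t \<longleftrightarrow> u \<in> t \<and> 1 \<le> i \<and> i \<le> num_children t u"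
proof (cases "u \<in> t")
  case True
  have "u @ [i] \<in> t \<longleftrightarrow> i \<in> children t u" by (simp add: children_def)
  then show ?thesis using True by (simp add: children_eq_interval[OF assms])
next
  case False
  then show ?thesis using parent_in_tree[of t u "[i]"] assms by (auto simp: finite_branching_trees_def)
qed

text \<open>
  To recognise a tree it suffices to know the children of each of its vertices: being a set of
  words and being closed under prefixes then follow by induction on the last letter.
\<close>

lemma finite_branching_treesI:
  assumes "[] \<in> t" and "\<And>u i. u @ [i] \<in> t \<longleftrightarrow> u \<in> t \<and> 1 \<le> i \<and> i \<le> k u"
  shows "t \<in> finite_branching_trees" and "u \<in> t \<Longrightarrow> num_children t u = k u"
proof -
  have words: "u \<in> words" if "u \<in> t" for u
    using that by (induction u rule: rev_induct) (auto simp: words_def assms(2))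
  have prefix: "u @ v \<in> t \<Longrightarrow> u \<in> t" for u v
  proof (induction v rule: rev_induct)
    case (snoc i v)
    then show ?case using assms(2)[of "u @ v" i] by auto
  qed simp
  have ch: "children t u = {1..k u}" if "u \<in> t" for u
    using that by (auto simp: children_def assms(2))
  have "\<forall>u\<in>t. \<exists>k::enat. \<forall>i\<ge>1. u @ [i] \<in> t \<longleftrightarrow> enat i \<le> k"
    using assms(2) by (metis enat_ord_simps(1))
  moreover have "t \<subseteq> words" "\<forall>u v. u @ v \<in> t \<longrightarrow> u \<in> t"
    using words prefix by blast+
  ultimately have "t \<in> all_trees"
    using assms(1) by (simp add: all_trees_def)
  then show "t \<in> finite_branching_trees"
    by (simp add: finite_branching_trees_def ch)
  show "u \<in> t \<Longrightarrow> num_children t u = k u"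
    by (simp add: ch num_children_def)
qed

lemma level_0: "t \<in> all_trees \<Longrightarrow> level 0 t = {[]}"
  using root_in_tree by (auto simp: level_def)

lemma level_Suc:
  assumes "t \<in> finite_branching_trees"
  shows "level (Suc h) t = (\<lambda>(u, i). u @ [i]) ` (SIGMA u:level h t. {1..num_children t u})"
proof -
  have "\<exists>u i. v = u @ [i]" if "length v = Suc h" for v :: "nat list"
    using that by (metis length_0_conv nat.distinct(1) rev_exhaust)
  then have "v \<in> level (Suc h) t \<longleftrightarrow> (\<exists>u i. v = u @ [i] \<and> u \<in> level h t \<and> i \<in> {1..num_children t u})" for v
    using child_in_tree_iff[OF assms] unfolding level_def mem_Collect_eq atLeastAtMost_iff
    by (metis length_append_singleton nat.inject)
  then show ?thesis by (auto simp: image_iff)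
qed

lemma finite_level: "t \<in> finite_branching_trees \<Longrightarrow> finite (level h t)"
proof (induction h)
  case 0
  then show ?case using level_0 trees_upto_subset(2) by force
next
  case (Suc h)
  then show ?case by (simp add: level_Suc)
qed

lemma card_level_Suc:
  assumes "t \<in> finite_branching_trees"
  shows "gen_size (Suc h) t = (\<Sum>u\<in>level h t. num_children t u)"
proof -
  have "inj_on (\<lambda>(u, i). u @ [i]) (SIGMA u:level h t. {1..num_children t u})"
    by (auto simp: inj_on_def)
  then show ?thesis
    by (simp add: gen_size_eq_card_level level_Suc[OF assms] card_image finite_level[OF assms])
qed

lemma truncate_eq_UN_level: "truncate h t = (\<Union>k\<le>h. level k t)"
  by (auto simp: truncate_def level_def)

lemma finite_truncate: "t \<in> finite_branching_trees \<Longrightarrow> finite (truncate h t)"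
  by (simp add: truncate_eq_UN_level finite_level)

lemma truncate_ident: "t \<in> trees_upto h \<Longrightarrow> truncate h t = t"
  by (auto simp: truncate_def trees_upto_def)

lemma finite_trees_upto: "t \<in> trees_upto h \<Longrightarrow> finite t"
  by (metis finite_truncate subsetD trees_upto_subset(1) truncate_ident)

lemma countable_trees_upto: "countable (trees_upto h)"
  by (rule countable_subset[of _ "Collect finite"])
     (auto simp: finite_trees_upto countable_Collect_finite)

lemma truncate_in_trees_upto:
  assumes "t \<in> finite_branching_trees"
  shows "truncate h t \<in> trees_upto h"
    and "u \<in> t \<Longrightarrow> length u \<le> h \<Longrightarrow> num_children (truncate h t) u = (if length u < h then num_children t u else 0)"
proof -
  let ?k = "\<lambda>u. if length u < h then num_children t u else 0"
  have root: "[] \<in> truncate h t"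
    using assms root_in_tree by (auto simp: truncate_def finite_branching_trees_def)
  have iff: "u @ [i] \<in> truncate h t \<longleftrightarrow> u \<in> truncate h t \<and> 1 \<le> i \<and> i \<le> ?k u" for u i
    using child_in_tree_iff[OF assms, of u i] unfolding truncate_def by (cases "length u < h") auto
  have fb: "truncate h t \<in> finite_branching_trees"
    by (rule finite_branching_treesI[OF root iff])
  show "truncate h t \<in> trees_upto h"
    using fb by (auto simp: trees_upto_def truncate_def)
  show "u \<in> t \<Longrightarrow> length u \<le> h \<Longrightarrow> num_children (truncate h t) u = ?k u"
    by (rule finite_branching_treesI(2)[OF root iff]) (auto simp: truncate_def)
qed

lemma truncate_truncate: "h \<le> n \<Longrightarrow> truncate h (truncate n t) = truncate h t"
  by (auto simp: truncate_def)

lemma gen_size_truncate: "h \<le> n \<Longrightarrow> gen_size h (truncate n t) = gen_size h t"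
  by (auto simp: gen_size_def truncate_def intro!: arg_cong[where f = card])

text \<open>
  The inverse of truncation: a tree of height at most \<open>h + 1\<close> amounts to its truncation at height \<open>h\<close>
  together with the numbers of children of the vertices at height \<open>h\<close>.
\<close>

definition graft :: "nat \<Rightarrow> nat list set \<Rightarrow> (nat list \<Rightarrow> nat) \<Rightarrow> nat list set" where
  "graft h t k = t \<union> (\<lambda>(u, i). u @ [i]) ` (SIGMA u:level h t. {1..k u})"

lemma child_in_graft_iff:
  assumes "t \<in> trees_upto h"
  shows "u @ [i] \<in> graft h t k \<longleftrightarrow>
    u \<in> graft h t k \<and> 1 \<le> i \<and> i \<le> (if length u < h then num_children t u else if length u = h then k u else 0)"
proof -
  have fb: "t \<in> finite_branching_trees" and len: "\<And>u. u \<in> t \<Longrightarrow> length u \<le> h"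
    using assms by (auto simp: trees_upto_def)
  have new: "u @ [i] \<in> graft h t k \<longleftrightarrow> u @ [i] \<in> t \<or> u \<in> t \<and> length u = h \<and> 1 \<le> i \<and> i \<le> k u"
    by (auto simp: graft_def level_def)
  have old: "u \<in> graft h t k \<longleftrightarrow> u \<in> t" if "length u \<le> h"
    using that by (auto simp: graft_def level_def)
  show ?thesis
  proof (cases "length u \<le> h")
    case True
    then show ?thesis
      using len[of "u @ [i]"] unfolding new old[OF True] child_in_tree_iff[OF fb] by auto
  next
    case False
    then show ?thesis using len[of "u @ [i]"] by (auto simp: new)
  qed
qed

lemma graft_in_trees_upto:
  assumes "t \<in> trees_upto h"
  shows "graft h t k \<in> trees_upto (Suc h)"
    and "u \<in> level h t \<Longrightarrow> num_children (graft h t k) u = k u"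
proof -
  have root: "[] \<in> graft h t k"
    using assms root_in_tree trees_upto_subset by (auto simp: graft_def)
  note * = finite_branching_treesI[OF root child_in_graft_iff[OF assms]]
  show "graft h t k \<in> trees_upto (Suc h)"
    using *(1) assms by (auto simp: trees_upto_def graft_def level_def)
  show "u \<in> level h t \<Longrightarrow> num_children (graft h t k) u = k u"
    using *(2) by (auto simp: graft_def level_def)
qed

lemma truncate_graft: "t \<in> trees_upto h \<Longrightarrow> truncate h (graft h t k) = t"
  by (auto simp: truncate_def graft_def level_def trees_upto_def)

lemma level_truncate: "level h (truncate h t) = level h t"
  by (auto simp: level_def truncate_def)

lemma graft_truncate:
  assumes "t \<in> trees_upto (Suc h)" "\<And>u. u \<in> level h t \<Longrightarrow> k u = num_children t u"
  shows "graft h (truncate h t) k = t"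
proof -
  have fb: "t \<in> finite_branching_trees" using assms by (auto simp: trees_upto_def)
  have "(SIGMA u:level h t. {1..k u}) = (SIGMA u:level h t. {1..num_children t u})"
    using assms(2) by auto
  then have "graft h (truncate h t) k = truncate h t \<union> level (Suc h) t"
    unfolding graft_def level_truncate level_Suc[OF fb] by simp
  also have "\<dots> = truncate (Suc h) t"
    by (auto simp: truncate_def level_def)
  finally show ?thesis using truncate_ident[OF assms(1)] by simp
qed

lemma gen_size_graft:
  assumes "t \<in> trees_upto h"
  shows "gen_size (Suc h) (graft h t k) = (\<Sum>u\<in>level h t. k u)"
proof -
  have "level h (graft h t k) = level h t"
    using level_truncate[of h "graft h t k"] truncate_graft[OF assms] by simp
  moreover have "graft h t k \<in> finite_branching_trees"
    using graft_in_trees_upto(1)[OF assms] trees_upto_subset(1) by blast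
  ultimately show ?thesis
    using card_level_Suc[of "graft h t k" h] graft_in_trees_upto(2)[OF assms] by simp
qed

section \<open>Measurability of truncations\<close>

lemma openin_k_topology_singleton: "openin k_topology {Some k}" if "k \<ge> -1"
  using that unfolding k_topology_def
  by (auto simp: openin_Alexandroff_compactification)

lemma openin_k_val:
  assumes "openin k_topology U" "u \<in> words"
  shows "openin tree_topology {t \<in> all_trees. k_val t u \<in> U}"
proof -
  let ?P = "product_topology (\<lambda>_. k_topology) words"
  have "openin ?P {x \<in> topspace ?P. x u \<in> U}"
    by (rule openin_continuous_map_preimage[OF _ assms(1)])
       (rule continuous_map_product_projection[OF assms(2)])
  moreover have "restrict (k_val t) words \<in> topspace ?P" for t
    by (auto simp: k_topology_def k_val_def image_iff)
  ultimately show ?thesis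
    unfolding tree_topology_def openin_pullback_topology
    by (intro exI[of _ "{x \<in> topspace ?P. x u \<in> U}"]) (use assms in auto)
qed

lemma space_tree_borel: "space tree_borel = all_trees"
  by (simp add: tree_borel_def space_measure_of_conv)

lemma openin_imp_sets_tree_borel: "openin tree_topology U \<Longrightarrow> U \<in> sets tree_borel"
  using openin_subset[of tree_topology]
  by (auto simp: tree_borel_def topspace_tree_topology sets_measure_of intro!: sigma_sets.Basic)

text \<open>
  Outside a tree the function \<open>k_val\<close> takes the value \<open>- 1\<close>, which is an isolated point of the
  compactification.
\<close>

lemma sets_tree_borel_mem: "{t \<in> all_trees. u \<in> t} \<in> sets tree_borel"
proof (cases "u \<in> words")
  case True
  have "{t \<in> all_trees. u \<in> t} = space tree_borel - {t \<in> all_trees. k_val t u \<in> {Some (- 1)}}"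
    by (auto simp: space_tree_borel k_val_def)
  also have "\<dots> \<in> sets tree_borel"
    using openin_k_val[OF openin_k_topology_singleton True]
    by (intro sets.compl_sets openin_imp_sets_tree_borel) auto
  finally show ?thesis .
next
  case False
  then have "{t \<in> all_trees. u \<in> t} = {}" using tree_subset_words by blast
  then show ?thesis by (simp only: sets.empty_sets)
qed

lemma random_tree_mem_sets:
  assumes "random_tree M X"
  shows "{\<omega> \<in> space M. u \<in> X \<omega>} \<in> sets M"
proof -
  have X: "X \<in> measurable M tree_borel" using assms by (simp add: random_tree_def)
  then have "{\<omega> \<in> space M. u \<in> X \<omega>} = X -` {t \<in> all_trees. u \<in> t} \<inter> space M"
    using measurable_space[OF X] by (auto simp: space_tree_borel)
  with measurable_sets[OF X sets_tree_borel_mem] show ?thesis by simp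
qed

lemma truncate_eq_sets:
  assumes "\<And>u. {\<omega> \<in> space M. u \<in> X \<omega>} \<in> sets M"
  shows "{\<omega> \<in> space M. truncate h (X \<omega>) = t} \<in> sets M"
proof -
  have "{\<omega> \<in> space M. (u \<in> X \<omega> \<and> length u \<le> h) = (u \<in> t)} \<in> sets M" for u
  proof -
    have [measurable]: "Measurable.pred M (\<lambda>\<omega>. u \<in> X \<omega>)"
      using assms by (simp add: pred_def)
    show ?thesis by measurable
  qed
  then have "{\<omega> \<in> space M. \<forall>u. (u \<in> X \<omega> \<and> length u \<le> h) = (u \<in> t)} \<in> sets M"
    by (rule sets.sets_Collect_countable_All)
  then show ?thesis by (simp add: truncate_def set_eq_iff)
qed

lemma truncate_mem_sets:
  assumes "\<And>u. {\<omega> \<in> space M. u \<in> X \<omega>} \<in> sets M"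
    and "\<And>\<omega>. \<omega> \<in> space M \<Longrightarrow> X \<omega> \<in> finite_branching_trees"
  shows "{\<omega> \<in> space M. truncate h (X \<omega>) \<in> B} \<in> sets M"
proof -
  have "{\<omega> \<in> space M. truncate h (X \<omega>) \<in> B} =
      (\<Union>t\<in>B \<inter> trees_upto h. {\<omega> \<in> space M. truncate h (X \<omega>) = t})"
    using truncate_in_trees_upto(1)[OF assms(2)] by auto
  also have "\<dots> \<in> sets M"
    using countable_subset[OF _ countable_trees_upto, of "B \<inter> trees_upto h" h]
    by (intro sets.countable_UN') (auto intro: truncate_eq_sets[OF assms(1)])
  finally show ?thesis .
qed

text \<open>
  Truncations of finite-branching trees are finite sets of words, so they take only countably many
  values and measurability can be tested on single values.
\<close>

lemma truncate_measurable:
  assumes "\<And>u. {\<omega> \<in> space M. u \<in> X \<omega>} \<in> sets M"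
    and "\<And>\<omega>. \<omega> \<in> space M \<Longrightarrow> X \<omega> \<in> finite_branching_trees"
  shows "(\<lambda>\<omega>. truncate h (X \<omega>)) \<in> measurable M (count_space UNIV)"
proof (rule measurableI)
  fix B
  have "(\<lambda>\<omega>. truncate h (X \<omega>)) -` B \<inter> space M = {\<omega> \<in> space M. truncate h (X \<omega>) \<in> B}" by auto
  then show "(\<lambda>\<omega>. truncate h (X \<omega>)) -` B \<inter> space M \<in> sets M"
    using truncate_mem_sets[OF assms] by simp
qed simp

section \<open>Convergence in distribution from truncations\<close>

lemma k_val_cong_truncate:
  assumes "truncate h s = truncate h t" "length u < h"
  shows "k_val s u = k_val t u"
proof -
  have eq: "v \<in> s \<longleftrightarrow> v \<in> t" if "length v \<le> h" for v
    using assms(1) that unfolding truncate_def by blast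
  then have "children s u = children t u" using assms(2) by (simp add: children_def)
  then show ?thesis using eq[of u] assms(2) by (simp add: k_val_def num_children_def)
qed

text \<open>
  If \<open>s h\<close> agrees with \<open>t\<close> up to height \<open>h\<close>, then the number of children of each fixed word is eventually constant.
\<close>

lemma limitin_tree_topology_truncate:
  assumes "t \<in> all_trees" "\<And>h. s h \<in> all_trees" "\<And>h. truncate h (s h) = truncate h t"
  shows "limitin tree_topology s t sequentially"
  unfolding limitin_tree_topology
proof (intro conjI ballI assms(1) limitin_eventually)
  fix u
  show "k_val t u \<in> topspace k_topology"
    by (auto simp: k_topology_def k_val_def image_iff)
  show "\<forall>\<^sub>F n in sequentially. k_val (s n) u = k_val t u"
    using eventually_gt_at_top[of "length u"]
    by eventually_elim (rule k_val_cong_truncate[OF assms(3)])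
qed (use assms(2) in simp)

lemma continuous_tree_limit:
  assumes "continuous_map tree_topology euclideanreal f"
    and "t \<in> all_trees" "\<And>h. s h \<in> all_trees" "\<And>h. truncate h (s h) = truncate h t"
  shows "(\<lambda>h. f (s h)) \<longlonglongrightarrow> f t"
  using continuous_map_limit[OF assms(1) limitin_tree_topology_truncate[OF assms(2-4)]]
  by (simp add: comp_def)

text \<open>
  Otherwise there would be trees \<open>s h\<close> that agree with \<open>t\<close> up to height \<open>h\<close> and stay away from \<open>t\<close>
  under \<open>f\<close>; but such a sequence converges to \<open>t\<close>.
\<close>

lemma continuous_tree_local:
  assumes f: "continuous_map tree_topology euclideanreal f" and t: "t \<in> all_trees" and "e > 0"
  shows "\<exists>h. \<forall>s\<in>all_trees. truncate h s = truncate h t \<longrightarrow> \<bar>f s - f t\<bar> < e"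
proof (rule ccontr)
  assume "\<not> ?thesis"
  then have "\<forall>h. \<exists>s. s \<in> all_trees \<and> truncate h s = truncate h t \<and> \<bar>f s - f t\<bar> \<ge> e"
    by (meson not_le)
  then obtain s where s: "\<And>h. s h \<in> all_trees" "\<And>h. truncate h (s h) = truncate h t"
      "\<And>h. \<bar>f (s h) - f t\<bar> \<ge> e"
    by metis
  from tendstoD[OF continuous_tree_limit[OF f t s(1,2)] \<open>e > 0\<close>]
  have "\<forall>\<^sub>F h in sequentially. \<bar>f (s h) - f t\<bar> < e" by (simp add: dist_real_def)
  with s(3) show False by (simp add: not_less[symmetric])
qed

lemma continuous_tree_borel_measurable:
  assumes f: "continuous_map tree_topology euclideanreal f"
  shows "f \<in> borel_measurable tree_borel"
proof (rule borel_measurableI)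
  fix S :: "real set" assume "open S"
  then have "openin tree_topology {t \<in> topspace tree_topology. f t \<in> S}"
    by (intro openin_continuous_map_preimage[OF f]) simp
  moreover have "{t \<in> topspace tree_topology. f t \<in> S} = f -` S \<inter> space tree_borel"
    by (auto simp: topspace_tree_topology space_tree_borel)
  ultimately show "f -` S \<inter> space tree_borel \<in> sets tree_borel"
    using openin_imp_sets_tree_borel by simp
qed

lemma continuous_tree_measurable:
  assumes f: "continuous_map tree_topology euclideanreal f"
    and X: "\<And>u. {\<omega> \<in> space M. u \<in> X \<omega>} \<in> sets M"
      "\<And>\<omega>. \<omega> \<in> space M \<Longrightarrow> X \<omega> \<in> finite_branching_trees"
  shows "(\<lambda>\<omega>. f (X \<omega>)) \<in> borel_measurable M"
proof (rule borel_measurable_LIMSEQ_real)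
  fix h
  show "(\<lambda>\<omega>. f (truncate h (X \<omega>))) \<in> borel_measurable M"
    by (rule measurable_compose[OF truncate_measurable[OF X]]) auto
next
  fix \<omega> assume "\<omega> \<in> space M"
  note t = X(2)[OF this]
  show "(\<lambda>h. f (truncate h (X \<omega>))) \<longlonglongrightarrow> f (X \<omega>)"
    using t truncate_in_trees_upto(1)[OF t] trees_upto_subset
    by (intro continuous_tree_limit[OF f]) (auto simp: truncate_truncate)
qed

text \<open>
  The truncations have countably many values, so finitely many of them carry almost all the mass.
\<close>

lemma truncate_tight:
  assumes "prob_space M" and X: "\<And>u. {\<omega> \<in> space M. u \<in> X \<omega>} \<in> sets M"
      "\<And>\<omega>. \<omega> \<in> space M \<Longrightarrow> X \<omega> \<in> finite_branching_trees"
    and "e > 0"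
  obtains F where "finite F" "F \<subseteq> trees_upto h" "\<P>(\<omega> in M. truncate h (X \<omega>) \<notin> F) < e"
proof -
  interpret prob_space M by fact
  have S: "truncate h (X \<omega>) \<in> trees_upto h" if "\<omega> \<in> space M" for \<omega>
    using truncate_in_trees_upto(1)[OF X(2)[OF that]] .
  then have ne: "trees_upto h \<noteq> {}" using not_empty by blast
  define F where "F N = from_nat_into (trees_upto h) ` {..N}" for N
  define A where "A N = {\<omega> \<in> space M. truncate h (X \<omega>) \<in> F N}" for N
  have A: "range A \<subseteq> sets M" unfolding A_def using truncate_mem_sets[OF X] by auto
  have "incseq A" unfolding A_def F_def by (auto simp: incseq_def)
  moreover have "(\<Union>N. A N) = space M"
  proof
    show "space M \<subseteq> (\<Union>N. A N)"
    proof
      fix \<omega> assume \<omega>: "\<omega> \<in> space M"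
      then obtain N where "truncate h (X \<omega>) = from_nat_into (trees_upto h) N"
        using S range_from_nat_into[OF ne countable_trees_upto] by (metis rangeE)
      with \<omega> show "\<omega> \<in> (\<Union>N. A N)" by (auto simp: A_def F_def)
    qed
  qed (auto simp: A_def)
  ultimately have "(\<lambda>N. prob (A N)) \<longlonglongrightarrow> 1"
    using finite_Lim_measure_incseq[OF A] prob_space by simp
  then have "\<forall>\<^sub>F N in sequentially. 1 - e < prob (A N)"
    by (rule order_tendstoD) (use \<open>e > 0\<close> in simp)
  then obtain N where N: "1 - e < prob (A N)" by (auto simp: eventually_sequentially)
  have "A N \<in> sets M" using A by auto
  have "{\<omega> \<in> space M. truncate h (X \<omega>) \<notin> F N} = space M - A N" by (auto simp: A_def)
  then have "\<P>(\<omega> in M. truncate h (X \<omega>) \<notin> F N) < e"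
    using N prob_compl[OF \<open>A N \<in> sets M\<close>] by simp
  moreover have "finite (F N)" "F N \<subseteq> trees_upto h"
    using from_nat_into[OF ne] by (auto simp: F_def)
  ultimately show ?thesis using that by blast
qed

text \<open>
  Half of the portmanteau argument, for bounded nonnegative functions. The function \<open>g\<close> is bounded
  below by the function that replaces \<open>g t\<close> by the infimum of \<open>g\<close> over all trees with the same
  truncation at height \<open>h\<close>. Only the truncation of a tree matters for this lower bound, and by
  continuity it increases to \<open>g\<close> as \<open>h\<close> grows. Since \<open>g\<close> is nonnegative, the mass of \<open>Y n\<close> outside
  finitely many truncations can be dropped.
\<close>

lemma expectation_liminf_truncate:
  assumes g: "continuous_map tree_topology euclideanreal g"
    and bound: "\<And>t. t \<in> all_trees \<Longrightarrow> 0 \<le> g t" "\<And>t. t \<in> all_trees \<Longrightarrow> g t \<le> C"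
    and Y: "\<And>n. n \<ge> 1 \<Longrightarrow> random_tree (N n) (Y n)"
    and K: "prob_space K" and Z: "\<And>u. {\<omega> \<in> space K. u \<in> Z \<omega>} \<in> sets K"
      "\<And>\<omega>. \<omega> \<in> space K \<Longrightarrow> Z \<omega> \<in> finite_branching_trees"
    and conv: "\<And>h t. t \<in> trees_upto h \<Longrightarrow>
      (\<lambda>n. \<P>(\<omega> in N n. truncate h (Y n \<omega>) = t)) \<longlonglongrightarrow> \<P>(\<omega> in K. truncate h (Z \<omega>) = t)"
    and "e > 0"
  shows "\<forall>\<^sub>F n in sequentially. (\<integral>\<omega>. g (Z \<omega>) \<partial>K) - e < (\<integral>\<omega>. g (Y n \<omega>) \<partial>N n)"
proof -
  interpret K: prob_space K by fact
  \<comment> \<open>\<open>c h (truncate h t)\<close> is the largest lower bound of \<open>g t\<close> that depends on the truncation only.\<close>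
  define c where "c h t = (INF s\<in>{s \<in> all_trees. truncate h s = t}. g s)" for h t
  have Z_tree: "Z \<omega> \<in> all_trees" if "\<omega> \<in> space K" for \<omega>
    using Z(2)[OF that] trees_upto_subset by blast
  have bdd: "bdd_below (g ` {s \<in> all_trees. P s})" for P
    by (rule bdd_belowI[where m = 0]) (use bound(1) in auto)
  have c_le: "c h (truncate h t) \<le> g t" if "t \<in> all_trees" for h t
    unfolding c_def using that by (intro cINF_lower bdd) auto
  have c_ge: "m \<le> c h (truncate h t)"
    if "t \<in> all_trees" "\<And>s. s \<in> all_trees \<Longrightarrow> truncate h s = truncate h t \<Longrightarrow> m \<le> g s" for h t m
    unfolding c_def using that by (intro cINF_greatest) auto
  have c_bound: "0 \<le> c h (truncate h t)" "c h (truncate h t) \<le> C" if "t \<in> all_trees" for h t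
    using c_ge[OF that, of h 0] c_le[OF that, of h] bound that by force+
  have c_lim: "(\<lambda>h. c h (truncate h t)) \<longlonglongrightarrow> g t" if t: "t \<in> all_trees" for t
  proof (rule LIMSEQ_I)
    fix r :: real assume "r > 0"
    then obtain h0 where h0: "\<forall>s\<in>all_trees. truncate h0 s = truncate h0 t \<longrightarrow> \<bar>g s - g t\<bar> < r / 2"
      using continuous_tree_local[OF g t, of "r / 2"] by auto
    have "norm (c h (truncate h t) - g t) < r" if "h \<ge> h0" for h
    proof -
      have "g t - r / 2 \<le> c h (truncate h t)"
      proof (rule c_ge[OF t])
        fix s assume s: "s \<in> all_trees" "truncate h s = truncate h t"
        then have "truncate h0 s = truncate h0 t" using truncate_truncate[OF that] by metis
        with h0 s(1) have "\<bar>g s - g t\<bar> < r / 2" by blast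
        then show "g t - r / 2 \<le> g s" by linarith
      qed
      then show ?thesis using c_le[OF t, of h] \<open>r > 0\<close> by simp
    qed
    then show "\<exists>h0. \<forall>h\<ge>h0. norm (c h (truncate h t) - g t) < r" by blast
  qed
  have c_meas: "(\<lambda>\<omega>. c h (truncate h (Z \<omega>))) \<in> borel_measurable K" for h
    by (rule measurable_compose[OF truncate_measurable[OF Z]]) auto
  have "(\<lambda>h. \<integral>\<omega>. c h (truncate h (Z \<omega>)) \<partial>K) \<longlonglongrightarrow> (\<integral>\<omega>. g (Z \<omega>) \<partial>K)"
  proof (rule integral_dominated_convergence[where w = "\<lambda>_. C"])
    show "AE \<omega> in K. norm (c h (truncate h (Z \<omega>))) \<le> C" for h
      using c_bound[OF Z_tree] by (intro AE_I2) simp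
  qed (use c_meas continuous_tree_measurable[OF g Z] c_lim[OF Z_tree] in auto)
  then have "\<forall>\<^sub>F h in sequentially. (\<integral>\<omega>. g (Z \<omega>) \<partial>K) - e / 3 < (\<integral>\<omega>. c h (truncate h (Z \<omega>)) \<partial>K)"
    by (rule order_tendstoD) (use \<open>e > 0\<close> in simp)
  then obtain h where h: "(\<integral>\<omega>. g (Z \<omega>) \<partial>K) - e / 3 < (\<integral>\<omega>. c h (truncate h (Z \<omega>)) \<partial>K)"
    by (auto simp: eventually_sequentially)
  have C: "0 \<le> C"
    using bound[of "Z (SOME \<omega>. \<omega> \<in> space K)"] Z_tree some_in_eq[of "space K"] K.not_empty by force
  obtain F where F: "finite F" "F \<subseteq> trees_upto h"
      "\<P>(\<omega> in K. truncate h (Z \<omega>) \<notin> F) < e / (3 * (C + 1))"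
    using truncate_tight[OF K Z, of "e / (3 * (C + 1))" h] C \<open>e > 0\<close> by auto
  \<comment> \<open>The error \<open>e\<close> is split into three parts: replacing \<open>g\<close> by \<open>c h\<close>, restricting to \<open>F\<close>, and the limit on \<open>F\<close>.\<close>
  let ?A = "\<lambda>t. {\<omega> \<in> space K. truncate h (Z \<omega>) = t}" and ?R = "{\<omega> \<in> space K. truncate h (Z \<omega>) \<notin> F}"
  have R: "?R \<in> sets K"
    using truncate_mem_sets[OF Z, of h "- F"] by simp
  have A: "?A t \<in> sets K" for t by (rule truncate_eq_sets[OF Z(1)])
  have sum_ind: "(\<Sum>t\<in>F. c h t * indicator (?A t) \<omega>) = (if truncate h (Z \<omega>) \<in> F then c h (truncate h (Z \<omega>)) else 0)"
    if "\<omega> \<in> space K" for \<omega>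
  proof -
    have "(\<Sum>t\<in>F. c h t * indicator (?A t) \<omega>) = (\<Sum>t\<in>F. if truncate h (Z \<omega>) = t then c h t else 0)"
      using that by (intro sum.cong) auto
    then show ?thesis using F(1) by simp
  qed
  have "(\<integral>\<omega>. c h (truncate h (Z \<omega>)) \<partial>K) \<le>
      (\<integral>\<omega>. (\<Sum>t\<in>F. c h t * indicator (?A t) \<omega>) + C * indicator ?R \<omega> \<partial>K)"
  proof (rule integral_mono)
    show "integrable K (\<lambda>\<omega>. c h (truncate h (Z \<omega>)))"
      by (rule K.integrable_const_bound[where B = C, OF _ c_meas])
         (use c_bound[OF Z_tree] in \<open>auto intro!: AE_I2\<close>)
    show "integrable K (\<lambda>\<omega>. (\<Sum>t\<in>F. c h t * indicator (?A t) \<omega>) + C * indicator ?R \<omega>)"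
      using A R by (auto intro!: Bochner_Integration.integrable_add Bochner_Integration.integrable_sum simp: K.emeasure_eq_measure)
    show "c h (truncate h (Z \<omega>)) \<le> (\<Sum>t\<in>F. c h t * indicator (?A t) \<omega>) + C * indicator ?R \<omega>"
      if "\<omega> \<in> space K" for \<omega>
      unfolding sum_ind[OF that] using that c_bound(2)[OF Z_tree[OF that]] by simp
  qed
  also have "\<dots> = (\<Sum>t\<in>F. c h t * K.prob (?A t)) + C * K.prob ?R"
    using A R by (subst Bochner_Integration.integral_add) (auto simp: K.emeasure_eq_measure)
  finally have upper: "(\<integral>\<omega>. c h (truncate h (Z \<omega>)) \<partial>K) \<le> (\<Sum>t\<in>F. c h t * K.prob (?A t)) + C * K.prob ?R" .
  have "C * K.prob ?R \<le> (C + 1) * K.prob ?R" by (intro mult_right_mono) auto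
  also have "\<dots> \<le> (C + 1) * (e / (3 * (C + 1)))" using F(3) C by (intro mult_left_mono) auto
  also have "\<dots> = e / 3" using C by (simp add: add_nonneg_eq_0_iff divide_simps)
  finally have rest: "C * K.prob ?R \<le> e / 3" .
  have "(\<lambda>n. \<Sum>t\<in>F. c h t * \<P>(\<omega> in N n. truncate h (Y n \<omega>) = t)) \<longlonglongrightarrow> (\<Sum>t\<in>F. c h t * K.prob (?A t))"
    by (intro tendsto_sum tendsto_mult tendsto_const conv) (use F(2) in auto)
  then have "\<forall>\<^sub>F n in sequentially. (\<Sum>t\<in>F. c h t * K.prob (?A t)) - e / 3 <
      (\<Sum>t\<in>F. c h t * \<P>(\<omega> in N n. truncate h (Y n \<omega>) = t))"
    by (rule order_tendstoD) (use \<open>e > 0\<close> in simp)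
  with eventually_ge_at_top[of 1] show ?thesis
  proof eventually_elim
    case (elim n)
    note Yn = Y[OF elim(1)]
    interpret N: prob_space "N n" using Yn by (simp add: random_tree_def)
    let ?B = "\<lambda>t. {\<omega> \<in> space (N n). truncate h (Y n \<omega>) = t}"
    have Y_meas: "Y n \<in> measurable (N n) tree_borel" using Yn by (simp add: random_tree_def)
    have Y_tree: "Y n \<omega> \<in> all_trees" if "\<omega> \<in> space (N n)" for \<omega>
      using measurable_space[OF Y_meas that] by (simp add: space_tree_borel)
    have B: "?B t \<in> sets (N n)" for t by (rule truncate_eq_sets[OF random_tree_mem_sets[OF Yn]])
    have "(\<Sum>t\<in>F. c h t * N.prob (?B t)) = (\<integral>\<omega>. (\<Sum>t\<in>F. c h t * indicator (?B t) \<omega>) \<partial>N n)"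
      using B by (subst Bochner_Integration.integral_sum) (auto simp: N.emeasure_eq_measure)
    also have "\<dots> \<le> (\<integral>\<omega>. g (Y n \<omega>) \<partial>N n)"
    proof (rule integral_mono)
      show "integrable (N n) (\<lambda>\<omega>. \<Sum>t\<in>F. c h t * indicator (?B t) \<omega>)"
        using B by (auto simp: N.emeasure_eq_measure intro!: Bochner_Integration.integrable_sum)
      show "integrable (N n) (\<lambda>\<omega>. g (Y n \<omega>))"
        by (rule N.integrable_const_bound[where B = C])
           (use bound[OF Y_tree] measurable_compose[OF Y_meas continuous_tree_borel_measurable[OF g]]
            in \<open>auto intro!: AE_I2\<close>)
      show "(\<Sum>t\<in>F. c h t * indicator (?B t) \<omega>) \<le> g (Y n \<omega>)" if \<omega>: "\<omega> \<in> space (N n)" for \<omega>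
      proof -
        have "(\<Sum>t\<in>F. c h t * indicator (?B t) \<omega>) = (\<Sum>t\<in>F. if truncate h (Y n \<omega>) = t then c h t else 0)"
          using \<omega> by (intro sum.cong) auto
        then show ?thesis
          using F(1) c_le[OF Y_tree[OF \<omega>], of h] bound(1)[OF Y_tree[OF \<omega>]] by simp
      qed
    qed
    finally show ?case using elim(2) upper rest h by linarith
  qed
qed

text \<open>
  Apply the lower bound to \<open>C + f\<close> and to \<open>C - f\<close>, where \<open>C\<close> bounds \<open>\<bar>f\<bar>\<close>.
\<close>

lemma conv_in_distribution_truncate:
  assumes Y: "\<And>n. n \<ge> 1 \<Longrightarrow> random_tree (N n) (Y n)"
    and K: "prob_space K" and Z: "\<And>u. {\<omega> \<in> space K. u \<in> Z \<omega>} \<in> sets K"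
      "\<And>\<omega>. \<omega> \<in> space K \<Longrightarrow> Z \<omega> \<in> finite_branching_trees"
    and conv: "\<And>h t. t \<in> trees_upto h \<Longrightarrow>
      (\<lambda>n. \<P>(\<omega> in N n. truncate h (Y n \<omega>) = t)) \<longlonglongrightarrow> \<P>(\<omega> in K. truncate h (Z \<omega>) = t)"
  shows "conv_in_distribution tree_topology N Y K Z"
  unfolding conv_in_distribution_def
proof (intro allI impI, elim conjE)
  fix f :: "nat list set \<Rightarrow> real"
  assume f: "continuous_map tree_topology euclideanreal f" and "bounded (f ` topspace tree_topology)"
  then obtain C where C: "\<bar>f t\<bar> \<le> C" if "t \<in> all_trees" for t
    by (auto simp: bounded_iff topspace_tree_topology)
  interpret K: prob_space K by fact
  have Z_tree: "Z \<omega> \<in> all_trees" if "\<omega> \<in> space K" for \<omega>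
    using Z(2)[OF that] trees_upto_subset by blast
  have intK: "integrable K (\<lambda>\<omega>. f (Z \<omega>))"
    by (rule K.integrable_const_bound[where B = C])
       (use C[OF Z_tree] continuous_tree_measurable[OF f Z] in \<open>auto intro!: AE_I2\<close>)
  have intN: "integrable (N n) (\<lambda>\<omega>. f (Y n \<omega>))" and prob: "prob_space (N n)" if "n \<ge> 1" for n
  proof -
    interpret N: prob_space "N n" using Y[OF that] by (simp add: random_tree_def)
    have Y_meas: "Y n \<in> measurable (N n) tree_borel" using Y[OF that] by (simp add: random_tree_def)
    have "Y n \<omega> \<in> all_trees" if "\<omega> \<in> space (N n)" for \<omega>
      using measurable_space[OF Y_meas that] by (simp add: space_tree_borel)
    then show "integrable (N n) (\<lambda>\<omega>. f (Y n \<omega>))"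
      by (intro N.integrable_const_bound[where B = C])
         (use C measurable_compose[OF Y_meas continuous_tree_borel_measurable[OF f]] in \<open>auto intro!: AE_I2\<close>)
    show "prob_space (N n)" by unfold_locales
  qed
  show "(\<lambda>n. \<integral>\<omega>. f (Y n \<omega>) \<partial>N n) \<longlonglongrightarrow> (\<integral>\<omega>. f (Z \<omega>) \<partial>K)"
  proof (rule tendstoI)
    fix e :: real assume "e > 0"
    have "continuous_map tree_topology euclideanreal (\<lambda>t. C + f t)"
      "continuous_map tree_topology euclideanreal (\<lambda>t. C - f t)"
      by (intro continuous_intros f)+
    then have "\<forall>\<^sub>F n in sequentially. (\<integral>\<omega>. C + f (Z \<omega>) \<partial>K) - e < (\<integral>\<omega>. C + f (Y n \<omega>) \<partial>N n)"
      "\<forall>\<^sub>F n in sequentially. (\<integral>\<omega>. C - f (Z \<omega>) \<partial>K) - e < (\<integral>\<omega>. C - f (Y n \<omega>) \<partial>N n)"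
      using C by (intro expectation_liminf_truncate[where C = "2 * C", OF _ _ _ Y K Z conv \<open>e > 0\<close>]; fastforce simp: abs_le_iff)+
    with eventually_ge_at_top[of 1]
    show "\<forall>\<^sub>F n in sequentially. dist (\<integral>\<omega>. f (Y n \<omega>) \<partial>N n) (\<integral>\<omega>. f (Z \<omega>) \<partial>K) < e"
    proof eventually_elim
      case (elim n)
      interpret N: prob_space "N n" using prob[OF elim(1)] .
      show ?case
        using elim intK intN[OF elim(1)]
        by (simp add: dist_real_def K.prob_space N.prob_space abs_less_iff)
    qed
  qed
qed

section \<open>Generating functions and generation sizes\<close>

text \<open>
  The argument is complex because the identity theorem for power series that is applied in \<open>pgf_inject\<close>
  is a statement about analytic functions.
\<close>

definition pgf :: "nat pmf \<Rightarrow> complex \<Rightarrow> complex" where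
  "pgf p z = measure_pmf.expectation p (\<lambda>k. z ^ k)"

lemma norm_power_le_one: "norm (z :: complex) \<le> 1 \<Longrightarrow> norm (z ^ k) \<le> 1"
  by (simp add: norm_power power_le_one)

lemma integrable_power: "norm (z :: complex) \<le> 1 \<Longrightarrow> integrable (measure_pmf p) (\<lambda>k. z ^ k)"
  by (rule measure_pmf.integrable_const_bound[where B = 1]) (auto simp: norm_power_le_one)

lemma norm_pgf_le_one: "norm z \<le> 1 \<Longrightarrow> norm (pgf p z) \<le> 1"
  unfolding pgf_def
  by (rule order_trans[OF integral_norm_bound], rule measure_pmf.integral_le_const)
     (auto simp: norm_power_le_one integrable_power)

lemma pgf_sums:
  assumes "norm z \<le> 1"
  shows "(\<lambda>k. of_real (pmf p k) * z ^ k) sums pgf p z"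
proof -
  have "integrable (count_space UNIV) (\<lambda>k. pmf p k *\<^sub>R z ^ k)"
    using integrable_power[OF assms, of p]
    by (simp add: measure_pmf_eq_density integrable_density)
  from sums_integral_count_space_nat[OF this] show ?thesis
    by (simp add: pgf_def measure_pmf_eq_density integral_density scaleR_conv_of_real)
qed

text \<open>
  The generating function is the sum of the power series with coefficients \<open>pmf p k\<close>, whose radius of
  convergence is at least one, and the coefficients of a power series are determined by its sum near zero.
\<close>

lemma pgf_inject:
  assumes "\<And>z. norm z < 1 \<Longrightarrow> pgf p z = pgf q z"
  shows "p = q"
proof -
  define F where "F p = Abs_fps (\<lambda>k. complex_of_real (pmf p k))" for p
  have eval: "eval_fps (F p) z = pgf p z" if "norm z < 1" for p z
    using sums_unique[OF pgf_sums[of z p]] that by (simp add: eval_fps_def F_def)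
  have radius: "fps_conv_radius (F p) > 0" for p
  proof -
    have "summable (\<lambda>k. fps_nth (F p) k * 1 ^ k)"
      using pgf_sums[of 1 p] by (simp add: F_def sums_iff)
    then have "fps_conv_radius (F p) \<ge> norm (1 :: complex)"
      unfolding fps_conv_radius_def by (rule conv_radius_geI)
    moreover have "0 < ereal (norm (1 :: complex))" by simp
    ultimately show ?thesis by (rule less_le_trans[rotated])
  qed
  have "eventually (\<lambda>z. z \<in> ball 0 1) (nhds (0 :: complex))"
    by (rule eventually_nhds_in_open) auto
  then have "eventually (\<lambda>z. eval_fps (F p) z = eval_fps (F q) z) (nhds 0)"
    by eventually_elim (simp add: eval assms)
  then have "F p = F q"
    by (rule eval_fps_eqD[OF radius radius])
  then have "complex_of_real (pmf p k) = of_real (pmf q k)" for k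
    unfolding F_def by (metis fps_nth_Abs_fps)
  then show ?thesis by (intro pmf_eqI) simp
qed

lemma expectation_bind_pmf:
  fixes f :: "'a \<Rightarrow> complex"
  assumes "\<And>x. norm (f x) \<le> B"
  shows "measure_pmf.expectation (bind_pmf p q) f =
    measure_pmf.expectation p (\<lambda>y. measure_pmf.expectation (q y) f)"
proof -
  have real: "measure_pmf.expectation (bind_pmf p q) g =
      measure_pmf.expectation p (\<lambda>y. measure_pmf.expectation (q y) g)"
    if "\<And>x. \<bar>g x\<bar> \<le> B" for g :: "'a \<Rightarrow> real"
    unfolding measure_pmf_bind
    by (rule integral_bind[where K = "count_space UNIV" and B' = 1 and B = B])
       (use that in \<open>auto simp: measure_pmf.finite_measure_axioms measure_pmf_in_subprob_space
          intro!: AE_I2 measure_pmf.emeasure_le_1\<close>)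
  have int: "integrable (measure_pmf r) f" for r
    by (rule measure_pmf.integrable_const_bound[where B = B]) (use assms in auto)
  have B: "norm (measure_pmf.expectation r f) \<le> B" for r
    by (rule order_trans[OF integral_norm_bound], rule measure_pmf.integral_le_const)
       (use assms int in auto)
  have int': "integrable (measure_pmf p) (\<lambda>y. measure_pmf.expectation (q y) f)"
    by (rule measure_pmf.integrable_const_bound[where B = B]) (use B in auto)
  have "\<bar>Re (f x)\<bar> \<le> B" "\<bar>Im (f x)\<bar> \<le> B" for x
    using abs_Re_le_cmod[of "f x"] abs_Im_le_cmod[of "f x"] assms[of x] by linarith+
  then show ?thesis
    using real[of "\<lambda>x. Re (f x)"] real[of "\<lambda>x. Im (f x)"]
    by (intro complex_eqI) (simp_all add: int int')
qed

primrec iid_sum :: "nat pmf \<Rightarrow> nat \<Rightarrow> nat pmf" where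
  "iid_sum p 0 = return_pmf 0"
| "iid_sum p (Suc k) = bind_pmf p (\<lambda>i. map_pmf ((+) i) (iid_sum p k))"

lemma pgf_bind_pmf:
  "norm z \<le> 1 \<Longrightarrow> pgf (bind_pmf p q) z = measure_pmf.expectation p (\<lambda>y. pgf (q y) z)"
  unfolding pgf_def by (rule expectation_bind_pmf[where B = 1]) (simp add: norm_power_le_one)

lemma pgf_iid_sum: "norm z \<le> 1 \<Longrightarrow> pgf (iid_sum p k) z = pgf p z ^ k"
proof (induction k)
  case 0
  then show ?case by (simp add: pgf_def)
next
  case (Suc k)
  have "pgf (map_pmf ((+) i) (iid_sum p k)) z = z ^ i * pgf p z ^ k" for i
    using Suc by (simp add: pgf_def power_add)
  then show ?case
    using Suc by (simp add: pgf_bind_pmf) (simp add: pgf_def)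
qed

lemma pgf_random_sum:
  "norm z \<le> 1 \<Longrightarrow> pgf (bind_pmf q (iid_sum p)) z = pgf q (pgf p z)"
  by (simp add: pgf_bind_pmf pgf_iid_sum) (simp add: pgf_def)

lemma Pi_pmf_sum:
  "finite A \<Longrightarrow> map_pmf (\<lambda>f. \<Sum>x\<in>A. f x) (Pi_pmf A 0 (\<lambda>_. p)) = iid_sum p (card A)"
proof (induction A rule: finite_induct)
  case empty
  then show ?case by simp
next
  case (insert x A)
  have "map_pmf (\<lambda>f. \<Sum>x\<in>insert x A. f x) (Pi_pmf (insert x A) 0 (\<lambda>_. p)) =
      bind_pmf p (\<lambda>i. map_pmf (\<lambda>f. \<Sum>y\<in>insert x A. (f(x := i)) y) (Pi_pmf A 0 (\<lambda>_. p)))"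
    using insert.hyps by (simp add: Pi_pmf_insert' map_bind_pmf map_pmf_def bind_return_pmf bind_assoc_pmf)
  also have "\<dots> = bind_pmf p (\<lambda>i. map_pmf ((+) i) (map_pmf (\<lambda>f. \<Sum>y\<in>A. f y) (Pi_pmf A 0 (\<lambda>_. p))))"
  proof -
    have "(\<Sum>y\<in>insert x A. (f(x := i)) y) = i + (\<Sum>y\<in>A. f y)" for f :: "_ \<Rightarrow> nat" and i
      using insert.hyps by (auto intro!: sum.cong)
    then show ?thesis by (simp add: pmf.map_comp comp_def)
  qed
  finally show ?case using insert by simp
qed

lemma pmf_iid_sum_Suc:
  "pmf (iid_sum p (Suc k)) a = (\<Sum>i\<le>a. pmf p i * pmf (iid_sum p k) (a - i))"
proof -
  have shift: "pmf (map_pmf ((+) i) q) a = (if i \<le> a then pmf q (a - i) else 0)" for i and q :: "nat pmf"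
  proof (cases "i \<le> a")
    case True
    then show ?thesis using pmf_map_inj'[of "(+) i" q "a - i"] by simp
  next
    case False
    then have "a \<notin> set_pmf (map_pmf ((+) i) q)" by auto
    then show ?thesis using False by (simp add: pmf_eq_0_set_pmf)
  qed
  show ?thesis
    by (simp add: pmf_bind shift, subst integral_measure_pmf_real[where A = "{..a}"])
       (auto intro!: sum.cong split: if_splits)
qed

primrec gw_process :: "nat pmf \<Rightarrow> nat \<Rightarrow> nat \<Rightarrow> nat pmf" where
  "gw_process p 0 k = return_pmf k"
| "gw_process p (Suc m) k = bind_pmf (gw_process p m k) (iid_sum p)"

text \<open>
  The generating function of \<open>geo_offspring \<eta> q\<close>, written in the variable \<open>1 - z\<close>. In the variable
  \<open>1 / (1 - z)\<close> the map becomes affine, which is why compositions are easy to compute.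
  For \<open>\<eta> = q = 1\<close> it is the identity, the generating function of a population of size one.
\<close>

definition linear_fractional :: "real \<Rightarrow> real \<Rightarrow> complex \<Rightarrow> complex" where
  "linear_fractional \<eta> q z = 1 - of_real \<eta> * (1 - z) / (of_real q + (1 - of_real q) * (1 - z))"

lemma linear_fractional_denom_nonzero:
  assumes "0 < q" "q \<le> 1" "norm z \<le> 1"
  shows "complex_of_real q + (1 - of_real q) * (1 - z) \<noteq> 0"
proof
  assume "complex_of_real q + (1 - of_real q) * (1 - z) = 0"
  then have "of_real (1 - q) * z = 1" by (simp add: algebra_simps)
  then have "(1 - q) * norm z = 1"
    using assms by (metis abs_of_nonneg diff_ge_0_iff_ge norm_mult norm_of_real norm_one)
  moreover have "(1 - q) * norm z \<le> (1 - q) * 1" using assms by (intro mult_left_mono) auto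
  ultimately show False using assms by simp
qed

lemma pgf_geo_offspring:
  assumes "0 < \<eta>" "\<eta> < 1" "0 < q" "q < 1" "norm z \<le> 1"
  shows "pgf (geo_offspring \<eta> q) z = linear_fractional \<eta> q z"
proof -
  let ?r = "complex_of_real (1 - q) * z"
  have "norm ?r \<le> norm (complex_of_real (1 - q)) * 1"
    unfolding norm_mult using assms by (intro mult_left_mono) auto
  also have "\<dots> < 1" using assms by (simp del: of_real_diff)
  finally have r: "norm ?r < 1" .
  have denom: "1 - ?r \<noteq> 0" using r by auto
  have "(\<lambda>k. of_real (\<eta> * q) * z * ?r ^ k) sums (of_real (\<eta> * q) * z * (1 / (1 - ?r)))"
    by (intro sums_mult geometric_sums r)
  also have "(\<lambda>k. of_real (\<eta> * q) * z * ?r ^ k) = (\<lambda>k. of_real (pmf (geo_offspring \<eta> q) (Suc k)) * z ^ Suc k)"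
    using assms by (simp add: pmf_geo_offspring fun_eq_iff power_mult_distrib mult_ac)
  finally have "(\<lambda>k. of_real (pmf (geo_offspring \<eta> q) k) * z ^ k) sums
      (of_real (\<eta> * q) * z * (1 / (1 - ?r)) + of_real (1 - \<eta>))"
    using assms by (subst (asm) sums_Suc_iff) (simp add: pmf_geo_offspring)
  from sums_unique2[OF this pgf_sums] assms
  have "pgf (geo_offspring \<eta> q) z = of_real (\<eta> * q) * z * (1 / (1 - ?r)) + of_real (1 - \<eta>)" by simp
  also have "\<dots> = linear_fractional \<eta> q z"
  proof -
    have eq: "complex_of_real q + (1 - of_real q) * (1 - z) = 1 - ?r" by (simp add: algebra_simps)
    show ?thesis unfolding linear_fractional_def eq using denom by (simp add: field_simps)
  qed
  finally show ?thesis .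
qed

text \<open>
  With \<open>\<mu> = \<eta> / q\<close>, the \<open>n\<close>-fold composition of \<open>linear_fractional \<eta> q\<close> has the parameters
  \<open>\<mu>\<^sup>n / D\<^sub>n\<close> and \<open>1 / D\<^sub>n\<close>, where \<open>D\<^sub>n\<close> is this number.
\<close>

definition gen_denom :: "real \<Rightarrow> real \<Rightarrow> nat \<Rightarrow> real" where
  "gen_denom \<eta> q n = 1 + (1 - q) / \<eta> * (\<Sum>i=1..n. (\<eta> / q) ^ i)"

text \<open>
  This recursion is the one that composition with one more generation imposes on the denominators.
\<close>

lemma gen_denom_Suc:
  assumes "0 < \<eta>" "\<eta> < 1" "0 < q" "q < 1"
  shows "q * gen_denom \<eta> q (Suc n) = 1 + (gen_denom \<eta> q n - 1) * \<eta>"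
proof -
  have "(\<Sum>i=1..Suc n. x ^ i) = x * (1 + (\<Sum>i=1..n. x ^ i))" for x :: real
  proof (induction n)
    case (Suc n)
    have "(\<Sum>i=1..Suc (Suc n). x ^ i) = (\<Sum>i=1..Suc n. x ^ i) + x * x ^ Suc n" by simp
    also have "\<dots> = x * (1 + (\<Sum>i=1..n. x ^ i) + x ^ Suc n)"
      by (simp only: Suc.IH) (simp only: distrib_left)
    finally show ?case by (simp add: add.assoc)
  qed simp
  from this[of "\<eta> / q"] obtain S where S: "(\<Sum>i=1..n. (\<eta> / q) ^ i) = S"
      "(\<Sum>i=1..Suc n. (\<eta> / q) ^ i) = \<eta> / q * (1 + S)"
    by blast
  show ?thesis
    unfolding gen_denom_def S using assms by (simp add: field_simps)
qed

lemma gen_denom_ge_1: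
  assumes "0 < \<eta>" "\<eta> < 1" "0 < q" "q < 1"
  shows "gen_denom \<eta> q n \<ge> 1" and "n \<ge> 1 \<Longrightarrow> gen_denom \<eta> q n > 1"
proof -
  show "gen_denom \<eta> q n \<ge> 1"
    using assms by (auto simp: gen_denom_def intro!: divide_nonneg_pos mult_nonneg_nonneg sum_nonneg)
  show "gen_denom \<eta> q n > 1" if "n \<ge> 1"
    using assms that unfolding gen_denom_def by (auto intro!: divide_pos_pos mult_pos_pos sum_pos)
qed

lemma power_less_gen_denom:
  assumes "0 < \<eta>" "\<eta> < 1" "0 < q" "q < 1"
  shows "(\<eta> / q) ^ n \<le> gen_denom \<eta> q n" and "n \<ge> 1 \<Longrightarrow> (\<eta> / q) ^ n < gen_denom \<eta> q n"
proof -
  have step: "(\<eta> / q) ^ Suc n < gen_denom \<eta> q (Suc n)" if "(\<eta> / q) ^ n \<le> gen_denom \<eta> q n" for n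
  proof -
    have "q * (\<eta> / q) ^ Suc n = \<eta> * (\<eta> / q) ^ n" using assms by simp
    also have "\<dots> \<le> \<eta> * gen_denom \<eta> q n" using that assms by simp
    also have "\<dots> < 1 + (gen_denom \<eta> q n - 1) * \<eta>" using assms by (simp add: algebra_simps)
    finally have "q * (\<eta> / q) ^ Suc n < q * gen_denom \<eta> q (Suc n)"
      by (simp only: gen_denom_Suc[OF assms])
    then show ?thesis using assms(3) by (simp only: mult_less_cancel_left_pos)
  qed
  show le: "(\<eta> / q) ^ n \<le> gen_denom \<eta> q n" for n
  proof (induction n)
    case 0
    then show ?case by (simp add: gen_denom_def)
  next
    case (Suc n)
    then show ?case using step[of n] by simp
  qed
  show "n \<ge> 1 \<Longrightarrow> (\<eta> / q) ^ n < gen_denom \<eta> q n"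
    using step[OF le, of "n - 1"] by simp
qed

lemma linear_fractional_compose:
  assumes "0 < \<eta>" "\<eta> < 1" "0 < q" "q < 1" "norm z \<le> 1"
  shows "linear_fractional ((\<eta> / q) ^ n / gen_denom \<eta> q n) (1 / gen_denom \<eta> q n) (pgf (geo_offspring \<eta> q) z) =
    linear_fractional ((\<eta> / q) ^ Suc n / gen_denom \<eta> q (Suc n)) (1 / gen_denom \<eta> q (Suc n)) z"
proof -
  \<comment> \<open>With \<open>y = 1 - z\<close> the denominator of the inner map is \<open>w\<close>, and the identity reduces to the
    recursion \<open>rec\<close> between \<open>D\<close> and \<open>D'\<close>.\<close>
  define D D' y m where "D = complex_of_real (gen_denom \<eta> q n)" and "D' = complex_of_real (gen_denom \<eta> q (Suc n))"
    and "y = 1 - z" and "m = complex_of_real ((\<eta> / q) ^ n)"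
  define E Q w where "E = complex_of_real \<eta>" and "Q = complex_of_real q" and "w = Q + (1 - Q) * y"
  have D1: "gen_denom \<eta> q n \<ge> 1" "gen_denom \<eta> q (Suc n) \<ge> 1" using gen_denom_ge_1 assms by auto
  have nz: "D \<noteq> 0" "D' \<noteq> 0" "E \<noteq> 0" "Q \<noteq> 0" using D1 assms by (auto simp: D_def D'_def E_def Q_def)
  have w: "w \<noteq> 0"
    using linear_fractional_denom_nonzero[of q z] assms by (simp add: w_def Q_def y_def)
  have f: "pgf (geo_offspring \<eta> q) z = 1 - E * y / w"
    unfolding pgf_geo_offspring[OF assms] linear_fractional_def by (simp add: E_def y_def w_def Q_def)
  have rec: "Q * D' = 1 + (D - 1) * E"
    using arg_cong[OF gen_denom_Suc[OF assms(1-4), of n], of complex_of_real]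
    by (simp add: Q_def D'_def D_def E_def)
  have "linear_fractional ((\<eta> / q) ^ n / gen_denom \<eta> q n) (1 / gen_denom \<eta> q n) (pgf (geo_offspring \<eta> q) z)
      = 1 - (m / D) * (E * y / w) / (1 / D + (1 - 1 / D) * (E * y / w))"
    unfolding f linear_fractional_def by (simp add: m_def D_def)
  also have "(m / D) * (E * y / w) / (1 / D + (1 - 1 / D) * (E * y / w)) = m * E * y / (w + (D - 1) * E * y)"
    using nz w by (simp add: divide_simps) (simp add: algebra_simps)
  also have "w + (D - 1) * E * y = Q * (1 + (D' - 1) * y)"
    using rec unfolding w_def by algebra
  also have "m * E * y / (Q * (1 + (D' - 1) * y)) = (m * E / Q / D') * y / (1 / D' + (1 - 1 / D') * y)"
    using nz by (simp add: divide_simps)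
  also have "1 - \<dots> = linear_fractional ((\<eta> / q) ^ Suc n / gen_denom \<eta> q (Suc n)) (1 / gen_denom \<eta> q (Suc n)) z"
    unfolding linear_fractional_def by (simp add: m_def D'_def E_def Q_def y_def mult_ac)
  finally show ?thesis .
qed

lemma pgf_gw_process:
  assumes "0 < \<eta>" "\<eta> < 1" "0 < q" "q < 1" "norm z \<le> 1"
  shows "pgf (gw_process (geo_offspring \<eta> q) n k) z =
    linear_fractional ((\<eta> / q) ^ n / gen_denom \<eta> q n) (1 / gen_denom \<eta> q n) z ^ k"
  using assms(5)
proof (induction n arbitrary: z)
  case 0
  then show ?case by (simp add: pgf_def linear_fractional_def gen_denom_def)
next
  case (Suc n)
  then show ?case
    using linear_fractional_compose[OF assms(1-4) Suc.prems, of n]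
    by (simp add: pgf_random_sum norm_pgf_le_one)
qed

text \<open>
  Both sides have as generating function the \<open>k\<close>-th power of an \<open>n\<close>-fold composition. For \<open>n = 0\<close> the two
  parameters are equal to one, the degenerate case of a population that has not yet reproduced.
\<close>

lemma gw_process_geo_offspring:
  assumes "0 < \<eta>" "\<eta> < 1" "0 < q" "q < 1" "n \<ge> 1"
  shows "gw_process (geo_offspring \<eta> q) n k =
    iid_sum (geo_offspring ((\<eta> / q) ^ n / gen_denom \<eta> q n) (1 / gen_denom \<eta> q n)) k"
proof (rule pgf_inject)
  fix z :: complex assume z: "norm z < 1"
  have D: "gen_denom \<eta> q n > 1" "(\<eta> / q) ^ n < gen_denom \<eta> q n"
    using gen_denom_ge_1 power_less_gen_denom assms by auto
  have "0 < (\<eta> / q) ^ n / gen_denom \<eta> q n" "(\<eta> / q) ^ n / gen_denom \<eta> q n < 1"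
      "0 < 1 / gen_denom \<eta> q n" "1 / gen_denom \<eta> q n < 1"
    using D assms by auto
  with z show "pgf (gw_process (geo_offspring \<eta> q) n k) z =
    pgf (iid_sum (geo_offspring ((\<eta> / q) ^ n / gen_denom \<eta> q n) (1 / gen_denom \<eta> q n)) k) z"
    by (subst pgf_gw_process[OF assms(1-4)]) (simp_all add: pgf_iid_sum pgf_geo_offspring)
qed

section \<open>Growing a Galton--Watson tree level by level\<close>

text \<open>
  The probability that the first \<open>h\<close> generations of a Galton--Watson tree are those of \<open>t\<close>.
\<close>

definition tree_weight :: "nat pmf \<Rightarrow> nat \<Rightarrow> nat list set \<Rightarrow> real" where
  "tree_weight p h t = (\<Prod>u\<in>{u \<in> t. length u < h}. pmf p (num_children t u))"

definition grow :: "nat pmf \<Rightarrow> nat \<Rightarrow> nat list set \<Rightarrow> nat list set pmf" where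
  "grow p h t = map_pmf (graft h t) (Pi_pmf (level h t) 0 (\<lambda>_. p))"

text \<open>
  Adding generations is a Markov chain on finite trees. Describing truncated Galton--Watson trees by
  this chain turns the branching property into the composition of its transition laws.
\<close>

primrec growth :: "nat pmf \<Rightarrow> nat \<Rightarrow> nat \<Rightarrow> nat list set \<Rightarrow> nat list set pmf" where
  "growth p h 0 t = return_pmf t"
| "growth p h (Suc m) t = bind_pmf (growth p h m t) (grow p (h + m))"

lemma growth_add: "growth p h (m + l) t = bind_pmf (growth p h m t) (growth p (h + m) l)"
  by (induction l) (simp_all add: bind_return_pmf' bind_assoc_pmf add.assoc)

lemma set_pmf_grow:
  assumes "t \<in> trees_upto h" "t' \<in> set_pmf (grow p h t)"
  shows "t' \<in> trees_upto (Suc h)" "truncate h t' = t"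
  using assms graft_in_trees_upto(1)[of t h] truncate_graft[of t h] by (auto simp: grow_def)

lemma set_pmf_growth:
  assumes "t \<in> trees_upto h" "t' \<in> set_pmf (growth p h m t)"
  shows "t' \<in> trees_upto (h + m)" "truncate h t' = t"
proof -
  have "t' \<in> trees_upto (h + m) \<and> truncate h t' = t"
    using assms(2)
  proof (induction m arbitrary: t')
    case 0
    then show ?case using assms(1) truncate_ident by auto
  next
    case (Suc m)
    then obtain s where s: "s \<in> set_pmf (growth p h m t)" "t' \<in> set_pmf (grow p (h + m) s)" by auto
    from Suc.IH[OF s(1)] have "s \<in> trees_upto (h + m)" "truncate h s = t" by auto
    with set_pmf_grow[OF this(1) s(2)] truncate_truncate[of h "h + m" t'] show ?case by simp
  qed
  then show "t' \<in> trees_upto (h + m)" "truncate h t' = t" by auto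
qed

lemma gen_size_grow:
  assumes "t \<in> trees_upto h"
  shows "map_pmf (gen_size (Suc h)) (grow p h t) = iid_sum p (gen_size h t)"
proof -
  have "finite (level h t)" using assms trees_upto_subset(1) finite_level by blast
  from Pi_pmf_sum[OF this] show ?thesis
    by (simp add: grow_def pmf.map_comp comp_def gen_size_graft[OF assms] gen_size_eq_card_level[of h t])
qed

lemma gen_size_growth:
  assumes "t \<in> trees_upto h"
  shows "map_pmf (gen_size (h + m)) (growth p h m t) = gw_process p m (gen_size h t)"
proof (induction m)
  case 0
  then show ?case by simp
next
  case (Suc m)
  have "map_pmf (gen_size (h + Suc m)) (growth p h (Suc m) t) =
      bind_pmf (growth p h m t) (\<lambda>s. iid_sum p (gen_size (h + m) s))"
    using gen_size_grow[OF set_pmf_growth(1)[OF assms]]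
    by (auto simp: map_bind_pmf intro!: bind_pmf_cong)
  also have "\<dots> = gw_process p (Suc m) (gen_size h t)"
    by (simp add: Suc.IH[symmetric] bind_map_pmf)
  finally show ?case .
qed

lemma pmf_map_inj_on:
  assumes "inj_on f A" "set_pmf p \<subseteq> A" "x \<in> A"
  shows "pmf (map_pmf f p) (f x) = pmf p x"
proof (cases "x \<in> set_pmf p")
  case True
  then show ?thesis using assms by (intro pmf_map_inj) (auto intro: inj_on_subset)
next
  case False
  then have "f x \<notin> set_pmf (map_pmf f p)" using assms by (auto dest: inj_onD)
  then show ?thesis using False by (metis pmf_eq_0_set_pmf)
qed

text \<open>
  A tree of height at most \<open>h + 1\<close> arises by grafting in exactly one way, namely from its own numbers of
  children at height \<open>h\<close>.
\<close>

lemma pmf_grow: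
  assumes "t \<in> trees_upto (Suc h)"
  shows "pmf (grow p h (truncate h t)) t = (\<Prod>u\<in>level h t. pmf p (num_children t u))"
proof -
  let ?s = "truncate h t"
  have fb: "t \<in> finite_branching_trees" using assms by (auto simp: trees_upto_def)
  have fin: "finite (level h t)" by (rule finite_level[OF fb])
  have s: "?s \<in> trees_upto h" by (rule truncate_in_trees_upto(1)[OF fb])
  define k where "k u = (if u \<in> level h t then num_children t u else 0)" for u
  let ?A = "{f. \<forall>u. u \<notin> level h t \<longrightarrow> f u = (0 :: nat)}"
  have "inj_on (graft h ?s) ?A"
  proof (rule inj_onI, rule ext)
    fix f g u assume "f \<in> ?A" "g \<in> ?A" "graft h ?s f = graft h ?s g"
    then show "f u = g u"
      using graft_in_trees_upto(2)[OF s, of u f] graft_in_trees_upto(2)[OF s, of u g]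
      by (cases "u \<in> level h t") (simp_all add: level_truncate)
  qed
  moreover have "set_pmf (Pi_pmf (level h t) 0 (\<lambda>_. p)) \<subseteq> ?A"
    using set_Pi_pmf_subset[OF fin] .
  moreover have "k \<in> ?A" by (simp add: k_def)
  ultimately have "pmf (grow p h ?s) (graft h ?s k) = pmf (Pi_pmf (level h t) 0 (\<lambda>_. p)) k"
    unfolding grow_def level_truncate by (rule pmf_map_inj_on)
  moreover have "graft h ?s k = t"
    by (rule graft_truncate[OF assms]) (simp add: k_def)
  ultimately show ?thesis by (simp add: pmf_Pi[OF fin] k_def)
qed

lemma tree_weight_Suc:
  assumes "t \<in> finite_branching_trees"
  shows "tree_weight p (Suc h) t = tree_weight p h (truncate h t) * (\<Prod>u\<in>level h t. pmf p (num_children t u))"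
proof -
  have "{u \<in> t. length u < Suc h} = {u \<in> t. length u < h} \<union> level h t"
    "{u \<in> t. length u < h} \<inter> level h t = {}"
    by (auto simp: level_def)
  moreover have "finite {u \<in> t. length u < h}"
    by (rule finite_subset[OF _ finite_truncate[OF assms, of h]]) (auto simp: truncate_def)
  ultimately have "tree_weight p (Suc h) t = tree_weight p h t * (\<Prod>u\<in>level h t. pmf p (num_children t u))"
    using finite_level[OF assms, of h] by (simp add: tree_weight_def prod.union_disjoint)
  moreover have "tree_weight p h (truncate h t) = tree_weight p h t"
    unfolding tree_weight_def
    by (rule prod.cong) (auto simp: truncate_in_trees_upto(2)[OF assms], auto simp: truncate_def)
  ultimately show ?thesis by simp
qed

lemma trees_upto_0: "trees_upto 0 = {{[]}}"
proof -
  have "{[]} \<in> finite_branching_trees"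
    by (rule finite_branching_treesI[where k = "\<lambda>_. 0"]) auto
  moreover have "t = {[]}" if "t \<in> trees_upto 0" for t
    using that root_in_tree trees_upto_subset by (auto simp: trees_upto_def)
  ultimately show ?thesis by (auto simp: trees_upto_def)
qed

lemma pmf_growth_root:
  "t \<in> trees_upto h \<Longrightarrow> pmf (growth p 0 h {[]}) t = tree_weight p h t"
proof (induction h arbitrary: t)
  case 0
  then show ?case by (simp add: trees_upto_0 tree_weight_def)
next
  case (Suc h)
  have fb: "t \<in> finite_branching_trees" using Suc.prems by (auto simp: trees_upto_def)
  have "pmf (growth p 0 (Suc h) {[]}) t =
      (\<integral>s. pmf (grow p h s) t \<partial>measure_pmf (growth p 0 h {[]}))"
    by (simp add: pmf_bind)
  also have "\<dots> = (\<Sum>s\<in>{truncate h t}. pmf (grow p h s) t * pmf (growth p 0 h {[]}) s)"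
  proof (rule integral_measure_pmf_real)
    fix s assume "s \<in> set_pmf (growth p 0 h {[]})" "pmf (grow p h s) t \<noteq> 0"
    then show "s \<in> {truncate h t}"
      using set_pmf_growth(1)[of "{[]}" 0 s p h] set_pmf_grow(2)[of s h t p]
      by (simp add: trees_upto_0 set_pmf_iff)
  qed simp
  also have "\<dots> = tree_weight p (Suc h) t"
    using Suc.IH[OF truncate_in_trees_upto(1)[OF fb]]
    by (simp add: pmf_grow[OF Suc.prems] tree_weight_Suc[OF fb])
  finally show ?case .
qed

text \<open>
  Both laws live on the countable set of trees of height at most \<open>h\<close> and agree on singletons, by the
  product formula that defines a Galton--Watson tree.
\<close>

lemma galton_watson_truncate:
  assumes "galton_watson_tree M p \<tau>"
  shows "\<P>(\<omega> in M. truncate h (\<tau> \<omega>) \<in> B) = measure_pmf.prob (growth p 0 h {[]}) B"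
proof -
  interpret prob_space M using assms by (simp add: galton_watson_tree_def random_tree_def)
  have fb: "\<tau> \<omega> \<in> finite_branching_trees" if "\<omega> \<in> space M" for \<omega>
    using assms that by (simp add: galton_watson_tree_def)
  have meas: "(\<lambda>\<omega>. truncate h (\<tau> \<omega>)) \<in> measurable M (count_space UNIV)"
    using assms by (intro truncate_measurable random_tree_mem_sets fb)
      (auto simp: galton_watson_tree_def)
  have single: "\<P>(\<omega> in M. truncate h (\<tau> \<omega>) = t) = tree_weight p h t" if t: "t \<in> trees_upto h" for t
  proof (cases h)
    case 0
    then have "t = {[]}" using t trees_upto_0 by simp
    moreover have "truncate h (\<tau> \<omega>) = {[]}" if "\<omega> \<in> space M" for \<omega>
      using truncate_in_trees_upto(1)[OF fb[OF that], of h] 0 trees_upto_0 by simp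
    then have "{\<omega> \<in> space M. truncate h (\<tau> \<omega>) = {[]}} = space M" by auto
    ultimately show ?thesis by (simp add: 0 tree_weight_def prob_space)
  next
    case (Suc m)
    then have "{u \<in> t. length u < h} = truncate (h - 1) t" by (auto simp: truncate_def)
    then show ?thesis
      using assms t Suc unfolding galton_watson_tree_def trees_upto_iff_height tree_weight_def by auto
  qed
  have "distr M (count_space UNIV) (\<lambda>\<omega>. truncate h (\<tau> \<omega>)) = measure_pmf (growth p 0 h {[]})"
  proof (rule measure_eqI_countable_AE[OF _ _ _ _ countable_trees_upto[of h]])
    show "AE t in distr M (count_space UNIV) (\<lambda>\<omega>. truncate h (\<tau> \<omega>)). t \<in> trees_upto h"
      using truncate_in_trees_upto(1)[OF fb] by (subst AE_distr_iff[OF meas]) auto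
    show "AE t in growth p 0 h {[]}. t \<in> trees_upto h"
      using set_pmf_growth(1)[of "{[]}" 0] by (auto simp: AE_measure_pmf_iff trees_upto_0)
    fix t assume t: "t \<in> trees_upto h"
    have "(\<lambda>\<omega>. truncate h (\<tau> \<omega>)) -` {t} \<inter> space M = {\<omega> \<in> space M. truncate h (\<tau> \<omega>) = t}" by auto
    then show "emeasure (distr M (count_space UNIV) (\<lambda>\<omega>. truncate h (\<tau> \<omega>))) {t} =
        emeasure (growth p 0 h {[]}) {t}"
      using single[OF t] pmf_growth_root[OF t, of p]
      by (simp add: emeasure_distr[OF meas] emeasure_eq_measure emeasure_pmf_single)
  qed simp_all
  then have "measure (distr M (count_space UNIV) (\<lambda>\<omega>. truncate h (\<tau> \<omega>))) B = measure_pmf.prob (growth p 0 h {[]}) B"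
    by simp
  moreover have "(\<lambda>\<omega>. truncate h (\<tau> \<omega>)) -` B \<inter> space M = {\<omega> \<in> space M. truncate h (\<tau> \<omega>) \<in> B}" by auto
  ultimately show ?thesis by (simp add: measure_distr[OF meas])
qed

lemma prob_bind_pmf:
  "measure_pmf.prob (bind_pmf p f) B = measure_pmf.expectation p (\<lambda>x. measure_pmf.prob (f x) B)"
proof -
  have "measure_pmf.prob r B = pmf (map_pmf (\<lambda>s. s \<in> B) r) True" for r
    by (simp add: pmf_map vimage_def)
  then show ?thesis by (simp add: map_bind_pmf pmf_bind)
qed

text \<open>
  The chain \<open>growth\<close> must pass through \<open>t\<close> at height \<open>h\<close>, since growing never changes lower generations,
  and from there the sizes of the generations depend on \<open>t\<close> only through \<open>gen_size h t\<close>.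
\<close>

lemma galton_watson_branching:
  assumes gw: "galton_watson_tree M p \<tau>" and t: "t \<in> trees_upto h"
  shows "\<P>(\<omega> in M. truncate h (\<tau> \<omega>) = t \<and> gen_size (h + m) (\<tau> \<omega>) = a) =
    tree_weight p h t * pmf (gw_process p m (gen_size h t)) a"
proof -
  let ?B = "{s. truncate h s = t \<and> gen_size (h + m) s = a}"
  have "\<P>(\<omega> in M. truncate h (\<tau> \<omega>) = t \<and> gen_size (h + m) (\<tau> \<omega>) = a) =
      \<P>(\<omega> in M. truncate (h + m) (\<tau> \<omega>) \<in> ?B)"
    by (simp add: truncate_truncate gen_size_truncate)
  also have "\<dots> = measure_pmf.prob (bind_pmf (growth p 0 h {[]}) (growth p h m)) ?B"
    unfolding galton_watson_truncate[OF gw] growth_add by simp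
  also have "\<dots> = (\<integral>s. measure_pmf.prob (growth p h m s) ?B \<partial>measure_pmf (growth p 0 h {[]}))"
    by (rule prob_bind_pmf)
  also have "\<dots> = (\<Sum>s\<in>{t}. measure_pmf.prob (growth p h m s) ?B * pmf (growth p 0 h {[]}) s)"
  proof (rule integral_measure_pmf_real)
    fix s assume s: "s \<in> set_pmf (growth p 0 h {[]})" "measure_pmf.prob (growth p h m s) ?B \<noteq> 0"
    then obtain t' where "t' \<in> set_pmf (growth p h m s)" "t' \<in> ?B"
      unfolding measure_pmf_zero_iff by blast
    then show "s \<in> {t}"
      using s set_pmf_growth(1)[of "{[]}" 0 s p h] set_pmf_growth(2)[of s h t' p m]
      by (simp add: trees_upto_0)
  qed simp
  also have "\<dots> = tree_weight p h t * measure_pmf.prob (growth p h m t) ?B"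
    by (simp add: pmf_growth_root[OF t])
  also have "measure_pmf.prob (growth p h m t) ?B = measure_pmf.prob (growth p h m t) (gen_size (h + m) -` {a})"
    using set_pmf_growth(2)[OF t]
    by (intro measure_pmf.finite_measure_eq_AE) (auto simp: AE_measure_pmf_iff)
  also have "\<dots> = pmf (gw_process p m (gen_size h t)) a"
    by (simp add: gen_size_growth[OF t, symmetric] pmf_map)
  finally show ?thesis .
qed

section \<open>Truncations of the Kesten tree\<close>

lemma child_types_cong:
  assumes "\<And>i. T (u @ [i]) = T' (u @ [i])"
  shows "child_types T u = child_types T' u"
proof -
  have "u @ [i] \<in> dom T \<longleftrightarrow> u @ [i] \<in> dom T'" for i
    using assms by (simp add: domIff)
  then have "num_children (dom T) u = num_children (dom T') u"
    by (simp add: num_children_def children_def)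
  then show ?thesis using assms by (simp add: child_types_def)
qed

lemma length_child_types: "length (child_types T u) = num_children (dom T) u"
  by (simp add: child_types_def)

lemma child_type_nth:
  assumes "dom T \<in> finite_branching_trees" "u @ [Suc i] \<in> dom T"
  shows "i < length (child_types T u)" "T (u @ [Suc i]) = Some (child_types T u ! i)"
proof -
  show i: "i < length (child_types T u)"
    using assms child_in_tree_iff[OF assms(1), of u "Suc i"] by (simp add: length_child_types)
  have "[1..<Suc n] ! i = Suc i" if "i < n" for n
    using that by (subst nth_upt) auto
  then show "T (u @ [Suc i]) = Some (child_types T u ! i)"
    using i assms(2) unfolding child_types_def by (auto simp del: upt_Suc)
qed

text \<open>
  The length of the list of the types of the children gives their number, and its entries their types.
\<close>

lemma child_types_eqD:
  assumes fb: "dom T \<in> finite_branching_trees" "dom T' \<in> finite_branching_trees"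
    and "u \<in> dom T \<longleftrightarrow> u \<in> dom T'" and eq: "u \<in> dom T \<Longrightarrow> child_types T u = child_types T' u"
  shows "T (u @ [i]) = T' (u @ [i])"
proof (cases "u \<in> dom T")
  case True
  have same: "u @ [i] \<in> dom T \<longleftrightarrow> u @ [i] \<in> dom T'"
    using True assms arg_cong[OF eq[OF True], of length]
    unfolding child_in_tree_iff[OF fb(1)] child_in_tree_iff[OF fb(2)] length_child_types by simp
  show ?thesis
  proof (cases "u @ [i] \<in> dom T")
    case in_T: True
    then have "i \<ge> 1" using child_in_tree_iff[OF fb(1)] by blast
    then obtain j where "i = Suc j" by (cases i) auto
    then show ?thesis
      using in_T same child_type_nth(2)[OF fb(1), of u j] child_type_nth(2)[OF fb(2), of u j] eq[OF True] by simp
  next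
    case False
    then show ?thesis using same by (simp add: domIff)
  qed
next
  case False
  then have "u @ [i] \<notin> dom T" "u @ [i] \<notin> dom T'"
    using assms(3) child_in_tree_iff[OF fb(1)] child_in_tree_iff[OF fb(2)] by blast+
  then show ?thesis by (simp add: domIff)
qed

lemma dom_truncate_typed: "dom (truncate_typed h T) = truncate h (dom T)"
  by (auto simp: truncate_typed_def truncate_def)

lemma truncate_typed_Suc_eq_iff:
  assumes T: "dom T \<in> finite_branching_trees" and t: "dom t \<in> trees_upto (Suc h)"
  shows "truncate_typed (Suc h) T = t \<longleftrightarrow>
    truncate_typed h T = truncate_typed h t \<and> (\<forall>u\<in>level h (dom t). child_types T u = child_types t u)"
    (is "?L \<longleftrightarrow> ?R")
proof
  assume ?L
  then have eq: "T u = t u" if "length u \<le> Suc h" for u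
    using that by (auto simp: truncate_typed_def restrict_map_def)
  then have "truncate_typed h T = truncate_typed h t"
    by (auto simp: truncate_typed_def restrict_map_def fun_eq_iff)
  moreover have "child_types T u = child_types t u" if "u \<in> level h (dom t)" for u
    using that by (intro child_types_cong eq) (simp add: level_def)
  ultimately show ?R by blast
next
  assume R: ?R
  have t_fb: "dom t \<in> finite_branching_trees" using t trees_upto_subset by blast
  have le: "T u = t u" if "length u \<le> h" for u
    using fun_cong[OF conjunct1[OF R], of u] that by (simp add: truncate_typed_def)
  have eq: "T u = t u" if u: "length u = Suc h" for u
  proof -
    obtain w i where w: "u = w @ [i]" "length w = h"
      using u by (metis length_Suc_conv_rev)
    show ?thesis
      unfolding w(1)
    proof (rule child_types_eqD[OF T t_fb])
      show iff: "w \<in> dom T \<longleftrightarrow> w \<in> dom t" using le[of w] w(2) by (simp add: domIff)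
      assume "w \<in> dom T"
      then show "child_types T w = child_types t w" using R iff w(2) by (simp add: level_def)
    qed
  qed
  have "t u = None" if "length u > Suc h" for u
    using t that by (force simp: trees_upto_def)
  then show ?L
    using le eq by (auto simp: truncate_typed_def restrict_map_def fun_eq_iff le_Suc_eq)
qed

text \<open>
  A typed tree of height at most \<open>h + 1\<close> consists of its truncation at height \<open>h\<close> and of the types of
  the children of the vertices at height \<open>h\<close>; the branching property gives the probability of the latter.
\<close>

lemma multitype_GW_step:
  assumes "multitype_GW_tree M r \<xi> T" and t: "dom t \<in> trees_upto (Suc h)"
  shows "\<P>(\<omega> in M. truncate_typed (Suc h) (T \<omega>) = t) =
    \<P>(\<omega> in M. truncate_typed h (T \<omega>) = truncate_typed h t) *
    (\<Prod>u\<in>level h (dom t). pmf (\<xi> (the (t u))) (child_types t u))"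
proof -
  let ?s = "truncate_typed h t"
  have fb: "dom (T \<omega>) \<in> finite_branching_trees" if "\<omega> \<in> space M" for \<omega>
    using assms(1) that by (simp add: multitype_GW_tree_def)
  have t_fb: "dom t \<in> finite_branching_trees" using t trees_upto_subset by blast
  have s: "dom ?s \<in> trees_upto h"
    unfolding dom_truncate_typed by (rule truncate_in_trees_upto(1)[OF t_fb])
  have lev: "{u \<in> dom ?s. length u = h} = level h (dom t)"
    by (auto simp: dom_truncate_typed level_def truncate_def)
  have "{\<omega> \<in> space M. truncate_typed (Suc h) (T \<omega>) = t} =
      {\<omega> \<in> space M. truncate_typed h (T \<omega>) = ?s \<and>
         (\<forall>u\<in>dom ?s. length u = h \<longrightarrow> child_types (T \<omega>) u = child_types t u)}"
    using truncate_typed_Suc_eq_iff[OF fb t] lev by blast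
  then have "\<P>(\<omega> in M. truncate_typed (Suc h) (T \<omega>) = t) =
      \<P>(\<omega> in M. truncate_typed h (T \<omega>) = ?s \<and>
         (\<forall>u\<in>dom ?s. length u = h \<longrightarrow> child_types (T \<omega>) u = child_types t u))"
    by simp
  also have "\<dots> = \<P>(\<omega> in M. truncate_typed h (T \<omega>) = ?s) *
      (\<Prod>u\<in>{u \<in> dom ?s. length u = h}. pmf (\<xi> (the (?s u))) (child_types t u))"
    using assms(1) s unfolding multitype_GW_tree_def trees_upto_iff_height by blast
  also have "(\<Prod>u\<in>{u \<in> dom ?s. length u = h}. pmf (\<xi> (the (?s u))) (child_types t u)) =
      (\<Prod>u\<in>level h (dom t). pmf (\<xi> (the (t u))) (child_types t u))"
    unfolding lev by (rule prod.cong) (auto simp: level_def truncate_typed_def)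
  finally show ?thesis .
qed

text \<open>
  The typed tree in which the special vertices are the ancestors of \<open>v\<close>, including \<open>v\<close>.
\<close>

definition spined :: "nat list set \<Rightarrow> nat list \<Rightarrow> nat list \<rightharpoonup> kesten_type" where
  "spined t v u = (if u \<in> t then Some (if u = take (length u) v then Special else Normal) else None)"

lemma dom_spined [simp]: "dom (spined t v) = t"
  by (auto simp: spined_def split: if_splits)

lemma truncate_typed_spined:
  "length w = h \<Longrightarrow> truncate_typed h (spined t (w @ [i])) = spined (truncate h t) w"
  by (auto simp: truncate_typed_def restrict_map_def spined_def truncate_def fun_eq_iff)

lemma child_types_spined:
  assumes "t \<in> finite_branching_trees" "u \<in> t" "length u = length w" "i \<ge> 1"
  shows "child_types (spined t (w @ [i])) u =
    (if u = w then (replicate (num_children t u) Normal)[i - 1 := Special] else replicate (num_children t u) Normal)"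
proof (rule nth_equalityI)
  fix j assume "j < length (child_types (spined t (w @ [i])) u)"
  then have j: "j < num_children t u" by (simp add: length_child_types)
  then have "u @ [Suc j] \<in> t" using assms child_in_tree_iff[OF assms(1)] by simp
  then have "spined t (w @ [i]) (u @ [Suc j]) = Some (child_types (spined t (w @ [i])) u ! j)"
    using assms by (intro child_type_nth(2)) auto
  moreover have "spined t (w @ [i]) (u @ [Suc j]) = Some (if u = w \<and> Suc j = i then Special else Normal)"
    using \<open>u @ [Suc j] \<in> t\<close> assms(3) by (simp add: spined_def)
  ultimately show "child_types (spined t (w @ [i])) u ! j = (if u = w
      then (replicate (num_children t u) Normal)[i - 1 := Special] else replicate (num_children t u) Normal) ! j"
    using j assms(4) by (auto simp: nth_list_update split: if_splits)
qed (simp add: length_child_types)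

lemma pmf_kesten_offspring_Normal: "pmf (kesten_offspring p Normal) (replicate k Normal) = pmf p k"
proof -
  have "inj (\<lambda>k. replicate k Normal)" by (rule injI) (metis length_replicate)
  from pmf_map_inj'[OF this, of p k] show ?thesis by simp
qed

text \<open>
  The size-biasing factor \<open>k\<close> cancels against the probability \<open>1 / k\<close> of the position of the special child.
\<close>

lemma pmf_kesten_offspring_Special:
  assumes "integrable (measure_pmf p) real" "measure_pmf.expectation p real > 0" "i < k"
  shows "pmf (kesten_offspring p Special) ((replicate k Normal)[i := Special]) =
    pmf p k / measure_pmf.expectation p real"
proof -
  let ?x = "(replicate k Normal)[i := Special]"
  let ?f = "\<lambda>k. map_pmf (\<lambda>i. (replicate k Normal)[i := Special]) (pmf_of_set {..<k})"
  note size_biased = pmf_size_biased[OF assms(1,2)]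
  have "pmf (kesten_offspring p Special) ?x = (\<integral>k. pmf (?f k) ?x \<partial>measure_pmf (size_biased p))"
    by (simp add: pmf_bind)
  also have "\<dots> = (\<Sum>k\<in>{k}. pmf (?f k) ?x * pmf (size_biased p) k)"
  proof (rule integral_measure_pmf_real)
    fix k' assume "pmf (?f k') ?x \<noteq> 0"
    then have "?x \<in> set_pmf (?f k')" by (simp only: set_pmf_iff not_False_eq_True)
    then obtain j where "?x = (replicate k' Normal)[j := Special]" by auto
    from arg_cong[OF this, of length] show "k' \<in> {k}" by simp
  qed simp
  also have "\<dots> = pmf (?f k) ?x * pmf (size_biased p) k" by simp
  also have "pmf (?f k) ?x = pmf (pmf_of_set {..<k}) i"
  proof (rule pmf_map_inj)
    have ne: "{..<k} \<noteq> {}" using assms(3) by auto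
    show "inj_on (\<lambda>i. (replicate k Normal)[i := Special]) (set_pmf (pmf_of_set {..<k}))"
    proof (rule inj_onI)
      fix i j assume "i \<in> set_pmf (pmf_of_set {..<k})" "j \<in> set_pmf (pmf_of_set {..<k})"
        and eq: "(replicate k Normal)[i := Special] = (replicate k Normal)[j := Special]"
      then have "i < k" "j < k" using ne by auto
      with arg_cong[OF eq, of "\<lambda>xs. xs ! i"] show "i = j"
        by (auto simp: nth_list_update split: if_splits)
    qed
    show "i \<in> set_pmf (pmf_of_set {..<k})" using ne assms(3) by simp
  qed
  also have "pmf (pmf_of_set {..<k}) i = 1 / real k"
    using assms(3) by (subst pmf_of_set) auto
  finally show ?thesis using assms(3) by (simp add: size_biased)
qed

context
  fixes K :: "'c measure" and p :: "nat pmf" and T :: "'c \<Rightarrow> nat list \<rightharpoonup> kesten_type"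
  assumes T: "multitype_GW_tree K Special (kesten_offspring p) T"
begin

lemma kesten_truncate_0:
  assumes "\<omega> \<in> space K"
  shows "truncate_typed 0 (T \<omega>) = spined {[]} []"
  using T assms by (auto simp: multitype_GW_tree_def truncate_typed_def restrict_map_def spined_def fun_eq_iff)

text \<open>
  Along the spine each special vertex contributes \<open>p(k) / m\<close> in place of \<open>p(k)\<close>, where \<open>m\<close> is the mean of \<open>p\<close>,
  and there is one such vertex at each of the heights \<open>0, \<dots>, h - 1\<close>.
\<close>

lemma kesten_spined_prob:
  assumes "integrable (measure_pmf p) real" "measure_pmf.expectation p real > 0"
    and "t \<in> trees_upto h" "v \<in> level h t"
  shows "\<P>(\<omega> in K. truncate_typed h (T \<omega>) = spined t v) =
    tree_weight p h t / measure_pmf.expectation p real ^ h"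
  using assms(3,4)
proof (induction h arbitrary: t v)
  case 0
  then have "t = {[]}" "v = []" by (auto simp: trees_upto_0 level_def)
  moreover have "{\<omega> \<in> space K. truncate_typed 0 (T \<omega>) = spined {[]} []} = space K"
    using kesten_truncate_0 by blast
  moreover have "prob_space K" using T by (simp add: multitype_GW_tree_def)
  ultimately show ?case by (simp add: tree_weight_def prob_space.prob_space)
next
  case (Suc h)
  let ?m = "measure_pmf.expectation p real"
  have fb: "t \<in> finite_branching_trees" using Suc.prems trees_upto_subset by blast
  from Suc.prems(2) obtain w i where v: "v = w @ [i]" and w: "w \<in> level h t" and i: "1 \<le> i" "i \<le> num_children t w"
    unfolding level_Suc[OF fb] by auto
  have len: "length w = h" using w by (simp add: level_def)
  have offspring: "pmf (kesten_offspring p (the (spined t v u))) (child_types (spined t v) u) =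
      (if u = w then pmf p (num_children t u) / ?m else pmf p (num_children t u))" if "u \<in> level h t" for u
  proof -
    have u: "u \<in> t" "length u = length w" using that len by (auto simp: level_def)
    have "spined t v u = Some (if u = w then Special else Normal)"
      using u by (auto simp: spined_def v)
    then show ?thesis
      using child_types_spined[OF fb u i(1)] pmf_kesten_offspring_Special[OF assms(1,2), of "i - 1" "num_children t w"] i
        pmf_kesten_offspring_Normal[of p "num_children t u"]
      by (simp add: v del: kesten_offspring.simps)
  qed
  have fin: "finite (level h t)" by (rule finite_level[OF fb])
  have "(\<Prod>u\<in>level h t. pmf (kesten_offspring p (the (spined t v u))) (child_types (spined t v) u)) =
      (\<Prod>u\<in>level h t. pmf p (num_children t u) * (if u = w then 1 / ?m else 1))"
    using offspring by (intro prod.cong) auto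
  also have "\<dots> = (\<Prod>u\<in>level h t. pmf p (num_children t u)) / ?m"
    using fin w by (simp add: prod.distrib prod.delta)
  finally have prod: "(\<Prod>u\<in>level h t. pmf (kesten_offspring p (the (spined t v u))) (child_types (spined t v) u)) =
      (\<Prod>u\<in>level h t. pmf p (num_children t u)) / ?m" .
  have "\<P>(\<omega> in K. truncate_typed (Suc h) (T \<omega>) = spined t v) =
      \<P>(\<omega> in K. truncate_typed h (T \<omega>) = spined (truncate h t) w) *
      ((\<Prod>u\<in>level h t. pmf p (num_children t u)) / ?m)"
    using multitype_GW_step[OF T, of "spined t v" h] Suc.prems(1)
    unfolding dom_spined prod unfolding v truncate_typed_spined[OF len] by simp
  also have "\<P>(\<omega> in K. truncate_typed h (T \<omega>) = spined (truncate h t) w) = tree_weight p h (truncate h t) / ?m ^ h"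
    using w by (intro Suc.IH truncate_in_trees_upto(1)[OF fb]) (simp add: level_truncate)
  finally show ?case by (simp add: tree_weight_Suc[OF fb])
qed

text \<open>
  An offspring list of positive probability has exactly one special entry if the parent is special, and
  none if the parent is normal. By induction on the height the special vertices form a path from the root.
\<close>

lemma kesten_spined:
  assumes "integrable (measure_pmf p) real" "measure_pmf.expectation p real > 0"
    and "dom t \<in> trees_upto h" "\<P>(\<omega> in K. truncate_typed h (T \<omega>) = t) \<noteq> 0"
  shows "\<exists>v\<in>level h (dom t). t = spined (dom t) v"
  using assms(3,4)
proof (induction h arbitrary: t)
  case 0
  have "{\<omega> \<in> space K. truncate_typed 0 (T \<omega>) = t} \<noteq> {}"
    using 0(2) by (metis (no_types, lifting) measure_empty)
  then have "t = spined {[]} []" using kesten_truncate_0 by auto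
  then show ?case by (auto simp: level_def)
next
  case (Suc h)
  let ?t = "dom t"
  have fb: "?t \<in> finite_branching_trees" using Suc.prems trees_upto_subset by blast
  note step = multitype_GW_step[OF T Suc.prems(1)]
  \<comment> \<open>Both the truncation and all offspring lists at height \<open>h\<close> have positive probability.\<close>
  have "\<P>(\<omega> in K. truncate_typed h (T \<omega>) = truncate_typed h t) \<noteq> 0"
    using Suc.prems(2) unfolding step by auto
  then obtain w where w: "w \<in> level h ?t" and trunc: "truncate_typed h t = spined (truncate h ?t) w"
    using Suc.IH[of "truncate_typed h t"] truncate_in_trees_upto(1)[OF fb, of h]
    by (auto simp: dom_truncate_typed level_truncate)
  have len: "length w = h" using w by (simp add: level_def)
  have low: "t u = spined ?t w u" if "length u \<le> h" for u
    using fun_cong[OF trunc, of u] that by (simp add: truncate_typed_def spined_def truncate_def)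
  have offspring: "child_types t u \<in> set_pmf (kesten_offspring p (the (t u)))" if "u \<in> level h ?t" for u
    using Suc.prems(2) that finite_level[OF fb, of h] unfolding step by (auto simp: set_pmf_iff)
  have normal: "child_types t u = replicate (num_children ?t u) Normal" if u: "u \<in> level h ?t" "u \<noteq> w" for u
  proof -
    have "t u = Some Normal" using low[of u] u len by (auto simp: level_def spined_def)
    then obtain k where "child_types t u = replicate k Normal" using offspring[OF u(1)] by auto
    then show ?thesis using length_child_types[of t u] by simp
  qed
  have "t w = Some Special" using low[of w] w len by (auto simp: level_def spined_def)
  then obtain k where k: "k \<in> set_pmf (size_biased p)"
      and "child_types t w \<in> (\<lambda>i. (replicate k Normal)[i := Special]) ` set_pmf (pmf_of_set {..<k})"
    using offspring[OF w] by auto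
  moreover have "k \<noteq> 0"
    using k pmf_size_biased[OF assms(1,2), of k] by (auto simp: set_pmf_iff)
  then have "set_pmf (pmf_of_set {..<k}) = {..<k}" by (intro set_pmf_of_set) auto
  ultimately obtain j where "j < k" "child_types t w = (replicate k Normal)[j := Special]" by auto
  moreover from this have "k = num_children ?t w" using length_child_types[of t w] by simp
  ultimately have j: "j < num_children ?t w" "child_types t w = (replicate (num_children ?t w) Normal)[j := Special]"
    by auto
  have v: "w @ [Suc j] \<in> level (Suc h) ?t"
    using j(1) w child_in_tree_iff[OF fb] by (simp add: level_def)
  have "t x = spined ?t (w @ [Suc j]) x" for x
  proof (cases "length x \<le> h")
    case True
    then show ?thesis using low[OF True] len by (simp add: spined_def)
  next
    case False
    show ?thesis
    proof (cases "x \<in> ?t")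
      case x: True
      then have "length x = Suc h" using False Suc.prems(1) by (force simp: trees_upto_def)
      then obtain u i where ui: "x = u @ [i]" "length u = h"
        by (metis length_Suc_conv_rev)
      have u: "u \<in> level h ?t" "1 \<le> i" "i \<le> num_children ?t u"
        using x ui child_in_tree_iff[OF fb, of u i] by (auto simp: level_def)
      then obtain l where l: "i = Suc l" by (cases i) auto
      have "t x = Some (child_types t u ! l)"
        using child_type_nth(2)[OF fb, of u l] x ui l by simp
      also have "child_types t u ! l = (if u = w \<and> l = j then Special else Normal)"
      proof (cases "u = w")
        case True
        then show ?thesis using j u(3) l by (simp add: nth_list_update)
      next
        case False
        then show ?thesis using normal[OF u(1)] u(3) l by simp
      qed
      finally show ?thesis using x ui l len by (simp add: spined_def)
    next
      case False
      then show ?thesis by (simp add: spined_def domIff)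
    qed
  qed
  then show ?case using v by blast
qed

text \<open>
  There is one typed tree for each possible end \<open>v\<close> of the spine at height \<open>h\<close>, all with the same probability.
\<close>

lemma kesten_truncate_prob:
  assumes "integrable (measure_pmf p) real" "measure_pmf.expectation p real > 0" and t: "t \<in> trees_upto h"
  shows "\<P>(\<omega> in K. truncate h (dom (T \<omega>)) = t) =
    real (gen_size h t) * tree_weight p h t / measure_pmf.expectation p real ^ h"
proof -
  interpret prob_space K using T by (simp add: multitype_GW_tree_def)
  have [measurable]: "(\<lambda>\<omega>. T \<omega> u) \<in> measurable K (count_space UNIV)" for u
    using T by (simp add: multitype_GW_tree_def)
  define E where "E s = {\<omega> \<in> space K. truncate_typed h (T \<omega>) = s}" for s
  have E: "E s \<in> sets K" for s
  proof -
    have "{\<omega> \<in> space K. (if length u \<le> h then T \<omega> u else None) = s u} \<in> sets K" for u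
      by (cases "length u \<le> h") simp_all
    then have "{\<omega> \<in> space K. \<forall>u. (if length u \<le> h then T \<omega> u else None) = s u} \<in> sets K"
      by (rule sets.sets_Collect_countable_All)
    then show ?thesis by (simp add: E_def truncate_typed_def restrict_map_def fun_eq_iff)
  qed
  define S where "S = {s :: nat list \<rightharpoonup> kesten_type. dom s = t}"
  have "(UNIV :: kesten_type set) = {Special, Normal}" using kesten_type.exhaust by blast
  then have "finite (UNIV :: kesten_type set)" by (metis finite.emptyI finite.insertI)
  then have fin: "finite S"
    using finite_set_of_finite_maps[OF finite_trees_upto[OF t], of "UNIV :: kesten_type set"] by (simp add: S_def)
  have inj: "inj_on (spined t) (level h t)"
  proof (rule inj_onI)
    fix v w assume vw: "v \<in> level h t" "w \<in> level h t" "spined t v = spined t w"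
    from fun_cong[OF vw(3), of v] vw(1,2) show "v = w"
      by (auto simp: spined_def level_def split: if_splits)
  qed
  have disjoint: "disjoint_family_on E S" by (auto simp: disjoint_family_on_def E_def)
  have "{\<omega> \<in> space K. truncate h (dom (T \<omega>)) = t} = (\<Union>s\<in>S. E s)"
    unfolding E_def S_def dom_truncate_typed[symmetric] by blast
  then have "\<P>(\<omega> in K. truncate h (dom (T \<omega>)) = t) = (\<Sum>s\<in>S. prob (E s))"
    using E by (simp add: finite_measure_finite_Union[OF fin] disjoint image_subset_iff)
  also have "\<dots> = (\<Sum>s\<in>spined t ` level h t. prob (E s))"
  proof (rule sum.mono_neutral_right[OF fin])
    show "spined t ` level h t \<subseteq> S" unfolding S_def using dom_spined by blast
    show "\<forall>s\<in>S - spined t ` level h t. prob (E s) = 0"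
      using kesten_spined[OF assms(1,2)] t unfolding S_def E_def by blast
  qed
  also have "\<dots> = (\<Sum>v\<in>level h t. tree_weight p h t / measure_pmf.expectation p real ^ h)"
    using kesten_spined_prob[OF assms(1,2) t] by (simp add: sum.reindex[OF inj] E_def)
  finally show ?thesis by (simp add: gen_size_eq_card_level)
qed

end

section \<open>The conditioned generation sizes\<close>

lemma pmf_iid_sum_0: "pmf (iid_sum p k) 0 = pmf p 0 ^ k"
proof (induction k)
  case (Suc k)
  then show ?case by (simp only: pmf_iid_sum_Suc) simp
qed simp

lemma sum_atMost_split_ends:
  "a \<ge> 1 \<Longrightarrow> (\<Sum>i\<le>a. f i) = f 0 + f a + (\<Sum>i=1..<a. f i)" for f :: "nat \<Rightarrow> real"
proof -
  assume "a \<ge> 1"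
  then have "{..a} = insert 0 (insert a {1..<a})" by auto
  then show ?thesis using \<open>a \<ge> 1\<close> by simp
qed

lemma pmf_geo_offspring_mult:
  assumes "0 < \<eta>" "\<eta> < 1" "0 < q" "q < 1" "1 \<le> i" "i < a"
  shows "pmf (geo_offspring \<eta> q) i * pmf (geo_offspring \<eta> q) (a - i) =
    \<eta> * q / (1 - q) * pmf (geo_offspring \<eta> q) a"
proof -
  obtain j l where "i = Suc j" "a = Suc j + Suc l"
    using assms(5,6) by (metis Suc_le_D less_iff_Suc_add One_nat_def add_Suc_right)
  then show ?thesis using assms(1-4) by (simp add: pmf_geo_offspring power_add)
qed

text \<open>
  For \<open>1 \<le> i < a\<close> the product \<open>G(i) G(a - i)\<close> of two geometric probabilities is \<open>G(a)\<close> times a constant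
  that does not depend on \<open>i\<close>. So if \<open>w\<close> is dominated by \<open>G\<close>, the part of the convolution in which both terms are
  nonzero is at most \<open>G(a)\<close> times a factor proportional to \<open>a\<close>.
\<close>

lemma geo_convolution_bound:
  fixes w :: "nat \<Rightarrow> real"
  assumes \<eta>q: "0 < \<eta>" "\<eta> < 1" "0 < q" "q < 1" and "C \<ge> 0"
    and w: "\<And>i. 1 \<le> i \<Longrightarrow> i < a \<Longrightarrow> w i \<le> C * pmf (geo_offspring \<eta> q) i"
  shows "(\<Sum>i=1..<a. pmf (geo_offspring \<eta> q) i * w (a - i)) \<le>
    C * (\<eta> * q * real a / (1 - q)) * pmf (geo_offspring \<eta> q) a"
proof -
  let ?G = "pmf (geo_offspring \<eta> q)"
  have "(\<Sum>i=1..<a. ?G i * w (a - i)) \<le> (\<Sum>i=1..<a. C * (\<eta> * q / (1 - q) * ?G a))"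
  proof (rule sum_mono)
    fix i assume i: "i \<in> {1..<a}"
    have "?G i * w (a - i) \<le> ?G i * (C * ?G (a - i))"
      using i by (intro mult_left_mono w) auto
    also have "\<dots> = C * (?G i * ?G (a - i))" by (simp only: mult.left_commute)
    also have "\<dots> = C * (\<eta> * q / (1 - q) * ?G a)"
      using i \<eta>q by (subst pmf_geo_offspring_mult) auto
    finally show "?G i * w (a - i) \<le> C * (\<eta> * q / (1 - q) * ?G a)" .
  qed
  also have "\<dots> = C * (\<eta> * q * real (a - 1) / (1 - q)) * ?G a" by simp
  also have "\<dots> \<le> C * (\<eta> * q * real a / (1 - q)) * ?G a"
    using \<eta>q \<open>C \<ge> 0\<close> by (intro mult_right_mono mult_left_mono divide_right_mono) auto
  finally show ?thesis .
qed

text \<open>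
  By induction on \<open>k\<close>: if \<open>b\<^sub>k\<close> is the constant for \<open>k\<close> summands, then one more summand leads to
  \<open>b\<^sub>k\<close> (the new one vanishes), plus \<open>1\<close> (only the new one does not vanish), plus \<open>b\<^sub>k\<close> (both parts are
  nonzero: the assumption on \<open>A\<close> bounds the factor in \<open>geo_convolution_bound\<close> by one).
  The constant \<open>2 ^ k - 1\<close> solves \<open>b\<^bsub>k+1\<^esub> = 2 b\<^sub>k + 1\<close>.
\<close>

lemma iid_sum_geo_bound:
  assumes \<eta>q: "0 < \<eta>" "\<eta> < 1" "0 < q" "q < 1"
    and A: "\<eta> * q * real A \<le> 1 - q" and "1 \<le> a" "a \<le> A"
  shows "pmf (iid_sum (geo_offspring \<eta> q) k) a \<le> (2 ^ k - 1) * pmf (geo_offspring \<eta> q) a"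
  using assms(6,7)
proof (induction k arbitrary: a)
  case 0
  then show ?case by simp
next
  case (Suc k)
  let ?G = "geo_offspring \<eta> q"
  have C: "(2::real) ^ k - 1 \<ge> 0" by simp
  have "(\<Sum>i=1..<a. pmf ?G i * pmf (iid_sum ?G k) (a - i)) \<le> (2 ^ k - 1) * (\<eta> * q * real a / (1 - q)) * pmf ?G a"
    using Suc.prems by (intro geo_convolution_bound \<eta>q C Suc.IH) auto
  also have "\<dots> \<le> (2 ^ k - 1) * 1 * pmf ?G a"
  proof (intro mult_right_mono mult_left_mono)
    have "\<eta> * q * real a \<le> \<eta> * q * real A" using \<eta>q Suc.prems by (intro mult_left_mono) auto
    also note A
    finally show "\<eta> * q * real a / (1 - q) \<le> 1" using \<eta>q by simp
  qed (use C in simp_all)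
  finally have middle: "(\<Sum>i=1..<a. pmf ?G i * pmf (iid_sum ?G k) (a - i)) \<le> (2 ^ k - 1) * pmf ?G a" by simp
  have "pmf ?G 0 * pmf (iid_sum ?G k) a \<le> 1 * ((2 ^ k - 1) * pmf ?G a)"
    using Suc by (intro mult_mono Suc.IH) (auto simp: pmf_le_1)
  moreover have "pmf ?G a * pmf (iid_sum ?G k) 0 \<le> pmf ?G a * 1"
    by (intro mult_left_mono) (simp_all add: pmf_le_1)
  ultimately have "pmf (iid_sum ?G (Suc k)) a \<le> 1 * ((2 ^ k - 1) * pmf ?G a) + pmf ?G a * 1 + (2 ^ k - 1) * pmf ?G a"
    unfolding pmf_iid_sum_Suc sum_atMost_split_ends[OF Suc.prems(1)] diff_zero diff_self_eq_0
    using middle by (intro add_mono)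
  then show ?case by (simp add: algebra_simps)
qed

text \<open>
  The same decomposition with an equality for the two main terms; only the contribution of two nonzero
  parts is estimated.
\<close>

lemma iid_sum_geo_step:
  assumes \<eta>q: "0 < \<eta>" "\<eta> < 1" "0 < q" "q < 1"
    and A: "\<eta> * q * real a \<le> 1 - q" and a: "1 \<le> a"
  defines "R \<equiv> \<lambda>k. pmf (iid_sum (geo_offspring \<eta> q) k) a / pmf (geo_offspring \<eta> q) a"
  shows "\<bar>R (Suc k) - ((1 - \<eta>) * R k + (1 - \<eta>) ^ k)\<bar> \<le> (2 ^ k - 1) * (\<eta> * q * real a / (1 - q))"
proof -
  let ?G = "geo_offspring \<eta> q"
  have pos: "pmf ?G a > 0" using \<eta>q a by (simp add: pmf_geo_offspring)
  let ?S = "\<Sum>i=1..<a. pmf ?G i * pmf (iid_sum ?G k) (a - i)"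
  have S0: "?S \<ge> 0" by (intro sum_nonneg) auto
  have "?S \<le> (2 ^ k - 1) * (\<eta> * q * real a / (1 - q)) * pmf ?G a"
    by (intro geo_convolution_bound \<eta>q iid_sum_geo_bound[OF \<eta>q A]) auto
  then have "?S / pmf ?G a \<le> (2 ^ k - 1) * (\<eta> * q * real a / (1 - q))"
    using pos by (simp add: pos_divide_le_eq)
  moreover have "pmf (iid_sum ?G (Suc k)) a = (1 - \<eta>) * pmf (iid_sum ?G k) a + pmf ?G a * (1 - \<eta>) ^ k + ?S"
    using a \<eta>q by (simp add: pmf_iid_sum_Suc sum_atMost_split_ends pmf_iid_sum_0 pmf_geo_offspring[of \<eta> q 0] del: iid_sum.simps)
  then have "R (Suc k) - ((1 - \<eta>) * R k + (1 - \<eta>) ^ k) = ?S / pmf ?G a"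
    using pos by (simp add: R_def field_simps)
  ultimately show ?thesis using S0 pos by simp
qed

text \<open>
  By \<open>iid_sum_geo_step\<close> the limits \<open>L\<^sub>k\<close> of the quotients satisfy \<open>L\<^bsub>k+1\<^esub> = c L\<^sub>k + c\<^sup>k\<close>, which gives \<open>k c\<^bsup>k-1\<^esup>\<close>:
  one of the \<open>k\<close> summands is equal to \<open>a n\<close> and the others vanish.
\<close>

lemma iid_sum_asymptotics:
  fixes \<eta> q :: "nat \<Rightarrow> real" and a :: "nat \<Rightarrow> nat"
  assumes range: "\<forall>\<^sub>F n in sequentially. 0 < \<eta> n \<and> \<eta> n < 1 \<and> 0 < q n \<and> q n < 1 \<and> a n \<ge> 1"
    and lim: "(\<lambda>n. \<eta> n) \<longlonglongrightarrow> 1 - c"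
    and small: "(\<lambda>n. \<eta> n * q n * real (a n) / (1 - q n)) \<longlonglongrightarrow> 0"
  shows "(\<lambda>n. pmf (iid_sum (geo_offspring (\<eta> n) (q n)) k) (a n) / pmf (geo_offspring (\<eta> n) (q n)) (a n))
    \<longlonglongrightarrow> real k * c ^ (k - 1)"
proof (induction k)
  case 0
  have "\<forall>\<^sub>F n in sequentially. pmf (iid_sum (geo_offspring (\<eta> n) (q n)) 0) (a n) / pmf (geo_offspring (\<eta> n) (q n)) (a n) = 0"
    using range by eventually_elim (simp add: pmf_return)
  then show ?case by (simp add: tendsto_eventually)
next
  case (Suc k)
  let ?R = "\<lambda>k n. pmf (iid_sum (geo_offspring (\<eta> n) (q n)) k) (a n) / pmf (geo_offspring (\<eta> n) (q n)) (a n)"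
  have c: "(\<lambda>n. 1 - \<eta> n) \<longlonglongrightarrow> c"
    using tendsto_diff[OF tendsto_const[of 1] lim] by simp
  have main: "(\<lambda>n. (1 - \<eta> n) * ?R k n + (1 - \<eta> n) ^ k) \<longlonglongrightarrow> c * (real k * c ^ (k - 1)) + c ^ k"
    by (intro tendsto_intros c Suc.IH)
  have "\<forall>\<^sub>F n in sequentially. \<eta> n * q n * real (a n) / (1 - q n) < 1"
    using small by (rule order_tendstoD) simp
  with range have "\<forall>\<^sub>F n in sequentially. norm (?R (Suc k) n - ((1 - \<eta> n) * ?R k n + (1 - \<eta> n) ^ k))
      \<le> (2 ^ k - 1) * (\<eta> n * q n * real (a n) / (1 - q n))"
    by eventually_elim (simp only: real_norm_def, rule iid_sum_geo_step, simp_all)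
  moreover have "(\<lambda>n. (2 ^ k - 1) * (\<eta> n * q n * real (a n) / (1 - q n))) \<longlonglongrightarrow> 0"
    using tendsto_mult_left[OF small, of "2 ^ k - 1"] by simp
  ultimately have "(\<lambda>n. ?R (Suc k) n - ((1 - \<eta> n) * ?R k n + (1 - \<eta> n) ^ k)) \<longlonglongrightarrow> 0"
    by (rule Lim_null_comparison)
  from tendsto_add[OF this main]
  have "?R (Suc k) \<longlonglongrightarrow> c * (real k * c ^ (k - 1)) + c ^ k" by simp
  moreover have "c * (real k * c ^ (k - 1)) + c ^ k = real (Suc k) * c ^ (Suc k - 1)"
    by (cases k) (simp_all add: algebra_simps)
  ultimately show ?case by (simp only:)
qed

lemma gen_denom_noncritical:
  assumes "0 < \<eta>" "\<eta> < 1" "0 < q" "q < 1" "\<eta> \<noteq> q"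
  shows "gen_denom \<eta> q n = (\<eta> - 1) / (\<eta> - q) + (1 - q) / (\<eta> - q) * (\<eta> / q) ^ n"
proof (induction n)
  case 0
  have "(\<eta> - 1) / (\<eta> - q) + (1 - q) / (\<eta> - q) = 1"
    using assms by (simp flip: add_divide_distrib)
  then show ?case by (simp add: gen_denom_def)
next
  case (Suc n)
  define X where "X = (\<eta> / q) ^ n"
  have "q * gen_denom \<eta> q (Suc n) = q * ((\<eta> - 1) / (\<eta> - q) + (1 - q) / (\<eta> - q) * (\<eta> / q * X))"
    unfolding gen_denom_Suc[OF assms(1-4)] Suc.IH X_def[symmetric]
    using assms by (simp add: divide_simps) (simp add: algebra_simps)
  then show ?case using assms by (simp add: X_def)
qed

lemma gen_denom_critical:
  assumes "0 < q"
  shows "gen_denom q q n = 1 + (1 - q) / q * real n"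
  using assms by (simp add: gen_denom_def)

text \<open>
  The denominator \<open>D\<^sub>n\<close> converges to a constant greater than one if \<open>\<mu> < 1\<close>, grows linearly if \<open>\<mu> = 1\<close>
  and like \<open>\<mu>\<^sup>n\<close> if \<open>\<mu> > 1\<close>. Hence \<open>\<mu>\<^sup>n / (D\<^sub>n (D\<^sub>n - 1))\<close> is of order \<open>\<mu>\<^sup>n\<close>, \<open>n\<^sup>-\<^sup>2\<close> and \<open>\<mu>\<^sup>-\<^sup>n\<close> in the three
  regimes, which is the order that the assumptions compare with \<open>1 / a n\<close>.
\<close>

lemma gen_denom_asymptotics:
  fixes a :: "nat \<Rightarrow> nat"
  assumes \<eta>q: "0 < \<eta>" "\<eta> < 1" "0 < q" "q < 1" and \<mu>: "\<mu> = \<eta> / q"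
    and sub: "\<mu> < 1 \<Longrightarrow> (\<lambda>n. real (a n) * \<mu> ^ n) \<longlonglongrightarrow> 0"
    and crit: "\<mu> = 1 \<Longrightarrow> (\<lambda>n. real (a n) * real n powi (-2)) \<longlonglongrightarrow> 0"
    and super: "\<mu> > 1 \<Longrightarrow> (\<lambda>n. real (a n) * \<mu> powi (- int n)) \<longlonglongrightarrow> 0"
  shows "(\<lambda>n. \<mu> ^ n / gen_denom \<eta> q n) \<longlonglongrightarrow> 1 - min 1 ((1 - \<eta>) / (1 - q))"
    and "(\<lambda>n. gen_denom \<eta> q (n + h) / gen_denom \<eta> q n) \<longlonglongrightarrow> max 1 \<mu> ^ h"
    and "(\<lambda>n. real (a (n + h)) * (\<mu> ^ n / (gen_denom \<eta> q n * (gen_denom \<eta> q n - 1)))) \<longlonglongrightarrow> 0"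
proof -
  let ?D = "gen_denom \<eta> q"
  have "(\<lambda>n. \<mu> ^ n / ?D n) \<longlonglongrightarrow> 1 - min 1 ((1 - \<eta>) / (1 - q)) \<and>
    (\<lambda>n. ?D (n + h) / ?D n) \<longlonglongrightarrow> max 1 \<mu> ^ h \<and>
    (\<lambda>n. real (a (n + h)) * (\<mu> ^ n / (?D n * (?D n - 1)))) \<longlonglongrightarrow> 0"
  proof (cases \<mu> "1 :: real" rule: linorder_cases)
    case less
    then have \<eta>_less: "\<eta> < q" using \<mu> \<eta>q by simp
    \<comment> \<open>The limit of the denominators.\<close>
    define A where "A = (\<eta> - 1) / (\<eta> - q)"
    have "A = (1 - \<eta>) / (q - \<eta>)" unfolding A_def by (metis minus_diff_eq minus_divide_divide)
    then have A: "A > 1" using \<eta>_less \<eta>q by simp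
    have D: "?D = (\<lambda>n. A + (1 - q) / (\<eta> - q) * \<mu> ^ n)"
      using gen_denom_noncritical[OF \<eta>q] \<eta>_less by (auto simp: A_def \<mu>)
    have pow: "(\<lambda>n. \<mu> ^ n) \<longlonglongrightarrow> 0" using less \<mu> \<eta>q by (intro LIMSEQ_power_zero) simp
    have limD: "?D \<longlonglongrightarrow> A"
    proof -
      have "?D \<longlonglongrightarrow> A + (1 - q) / (\<eta> - q) * 0" unfolding D by (intro tendsto_intros pow)
      then show ?thesis by simp
    qed
    have "(\<lambda>n. \<mu> ^ n / ?D n) \<longlonglongrightarrow> 0 / A"
      by (intro tendsto_divide pow limD) (use A in simp)
    moreover have "min 1 ((1 - \<eta>) / (1 - q)) = 1" using \<eta>_less \<eta>q by simp
    moreover have "(\<lambda>n. ?D (n + h) / ?D n) \<longlonglongrightarrow> A / A"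
      by (intro tendsto_divide LIMSEQ_ignore_initial_segment limD) (use A in simp)
    moreover have "(\<lambda>n. real (a (n + h)) * \<mu> ^ (n + h) / \<mu> ^ h / (?D n * (?D n - 1))) \<longlonglongrightarrow> 0 / \<mu> ^ h / (A * (A - 1))"
      by (intro tendsto_divide tendsto_mult tendsto_diff tendsto_const limD
          LIMSEQ_ignore_initial_segment[OF sub[OF less]]) (use A \<mu> \<eta>q in auto)
    moreover have "real (a (n + h)) * \<mu> ^ (n + h) / \<mu> ^ h = real (a (n + h)) * \<mu> ^ n" for n
      using \<mu> \<eta>q by (simp add: power_add)
    ultimately show ?thesis using A less by simp
  next
    case equal
    then have [simp]: "\<eta> = q" using \<mu> \<eta>q by simp
    define \<beta> where "\<beta> = (1 - q) / q"
    have \<beta>: "\<beta> > 0" using \<eta>q by (simp add: \<beta>_def)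
    have D: "?D = (\<lambda>n. 1 + \<beta> * real n)"
      using gen_denom_critical[OF \<eta>q(3)] by (simp add: \<beta>_def fun_eq_iff)
    have "(\<lambda>n. 1 / (1 + \<beta> * real n)) \<longlonglongrightarrow> 0"
      using \<beta> by real_asymp
    moreover have "(\<lambda>n. (1 + \<beta> * real (n + h)) / (1 + \<beta> * real n)) \<longlonglongrightarrow> 1"
      using \<beta> by real_asymp
    moreover have "(\<lambda>n. real (a (n + h)) * (1 / ((1 + \<beta> * real n) * (\<beta> * real n)))) \<longlonglongrightarrow> 0"
    proof -
      have "(\<lambda>n. real (n + h) ^ 2 / ((1 + \<beta> * real n) * (\<beta> * real n))) \<longlonglongrightarrow> 1 / \<beta> ^ 2"
        using \<beta> by (real_asymp simp: field_simps power2_eq_square)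
      from tendsto_mult[OF LIMSEQ_ignore_initial_segment[OF crit[OF equal], of h] this]
      have "(\<lambda>n. real (a (n + h)) * real (n + h) powi (- 2) *
          (real (n + h) ^ 2 / ((1 + \<beta> * real n) * (\<beta> * real n)))) \<longlonglongrightarrow> 0" by simp
      moreover have "\<forall>\<^sub>F n in sequentially. real (a (n + h)) * real (n + h) powi (- 2) *
          (real (n + h) ^ 2 / ((1 + \<beta> * real n) * (\<beta> * real n))) =
          real (a (n + h)) * (1 / ((1 + \<beta> * real n) * (\<beta> * real n)))"
        using eventually_gt_at_top[of 0]
        by eventually_elim (simp add: power_int_minus field_simps)
      ultimately show ?thesis by (rule Lim_transform_eventually)
    qed
    ultimately show ?thesis using \<eta>q unfolding D by (simp add: equal)
  next
    case greater
    then have \<eta>_greater: "\<eta> > q" using \<mu> \<eta>q by simp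
    \<comment> \<open>The limit of \<open>D\<^sub>n / \<mu>\<^sup>n\<close>; its inverse is the survival probability.\<close>
    define B where "B = (1 - q) / (\<eta> - q)"
    have B: "B > 0" using \<eta>_greater \<eta>q by (simp add: B_def)
    have pos: "\<mu> > 0" using greater by simp
    have D: "?D n = (1 - B) + B * \<mu> ^ n" for n
    proof -
      have "(\<eta> - 1) / (\<eta> - q) = 1 - B" using \<eta>_greater by (simp add: B_def field_simps)
      then show ?thesis using gen_denom_noncritical[OF \<eta>q] \<eta>_greater by (simp add: B_def \<mu>)
    qed
    have pow: "(\<lambda>n. 1 / \<mu> ^ n) \<longlonglongrightarrow> 0"
      using LIMSEQ_inverse_realpow_zero[OF greater] by (simp add: inverse_eq_divide)
    have limD: "(\<lambda>n. ?D n / \<mu> ^ n) \<longlonglongrightarrow> B"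
    proof -
      have "(\<lambda>n. (1 - B) * (1 / \<mu> ^ n) + B) \<longlonglongrightarrow> (1 - B) * 0 + B" by (intro tendsto_intros pow)
      moreover have "(1 - B) * (1 / \<mu> ^ n) + B = ?D n / \<mu> ^ n" for n
        using pos by (simp add: D field_simps)
      ultimately show ?thesis by simp
    qed
    have limD': "(\<lambda>n. (?D n - 1) / \<mu> ^ n) \<longlonglongrightarrow> B"
      using tendsto_diff[OF limD pow] by (simp add: diff_divide_distrib)
    have "(\<lambda>n. 1 / (?D n / \<mu> ^ n)) \<longlonglongrightarrow> 1 / B"
      by (intro tendsto_divide tendsto_const limD) (use B in simp)
    then have "(\<lambda>n. \<mu> ^ n / ?D n) \<longlonglongrightarrow> 1 / B" by simp
    moreover have "1 / B = 1 - min 1 ((1 - \<eta>) / (1 - q))"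
      using \<eta>_greater \<eta>q by (simp add: B_def field_simps)
    moreover have "(\<lambda>n. (?D (n + h) / \<mu> ^ (n + h)) * \<mu> ^ h / (?D n / \<mu> ^ n)) \<longlonglongrightarrow> B * \<mu> ^ h / B"
      by (intro tendsto_divide tendsto_mult tendsto_const limD LIMSEQ_ignore_initial_segment[OF limD])
         (use B in simp)
    then have "(\<lambda>n. ?D (n + h) / ?D n) \<longlonglongrightarrow> \<mu> ^ h"
      using pos B by (simp add: power_add)
    ultimately have limits: "(\<lambda>n. \<mu> ^ n / ?D n) \<longlonglongrightarrow> 1 - min 1 ((1 - \<eta>) / (1 - q))"
        "(\<lambda>n. ?D (n + h) / ?D n) \<longlonglongrightarrow> \<mu> ^ h"
      by simp_all
    \<comment> \<open>The last quantity is rewritten in terms of the two quotients above, which have the limit \<open>B\<close>.\<close>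
    have "(\<lambda>n. real (a (n + h)) * \<mu> powi (- int (n + h)) * \<mu> ^ h / ((?D n / \<mu> ^ n) * ((?D n - 1) / \<mu> ^ n)))
        \<longlonglongrightarrow> 0 * \<mu> ^ h / (B * B)"
      by (intro tendsto_divide tendsto_mult tendsto_const limD limD'
          LIMSEQ_ignore_initial_segment[OF super[OF greater]]) (use B in simp)
    moreover have last: "real (a (n + h)) * \<mu> powi (- int (n + h)) * \<mu> ^ h / ((?D n / \<mu> ^ n) * ((?D n - 1) / \<mu> ^ n)) =
        real (a (n + h)) * (\<mu> ^ n / (?D n * (?D n - 1)))" for n
    proof -
      have "\<mu> powi (- int (n + h)) = 1 / (\<mu> ^ n * \<mu> ^ h)"
        by (simp only: power_int_minus power_int_of_nat power_add inverse_eq_divide)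
      then show ?thesis using pos by simp
    qed
    ultimately have "(\<lambda>n. real (a (n + h)) * (\<mu> ^ n / (?D n * (?D n - 1)))) \<longlonglongrightarrow> 0"
      unfolding last by simp
    with limits show ?thesis using greater by simp
  qed
  then show "(\<lambda>n. \<mu> ^ n / gen_denom \<eta> q n) \<longlonglongrightarrow> 1 - min 1 ((1 - \<eta>) / (1 - q))"
    and "(\<lambda>n. gen_denom \<eta> q (n + h) / gen_denom \<eta> q n) \<longlonglongrightarrow> max 1 \<mu> ^ h"
    and "(\<lambda>n. real (a (n + h)) * (\<mu> ^ n / (gen_denom \<eta> q n * (gen_denom \<eta> q n - 1)))) \<longlonglongrightarrow> 0"
    by auto
qed

lemma gen_denom_diff:
  "gen_denom \<eta> q (n + h) - gen_denom \<eta> q n = (gen_denom \<eta> q h - 1) * (\<eta> / q) ^ n"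
proof -
  have "(\<Sum>i=1..n + h. x ^ i) = (\<Sum>i=1..n. x ^ i) + (\<Sum>i=1..h. x ^ i) * x ^ n" for x :: real
    by (induction h) (simp_all add: algebra_simps power_add)
  then show ?thesis by (simp only: gen_denom_def) (simp only: algebra_simps)
qed

text \<open>
  The quotient splits into three factors. The passage from \<open>k\<close> ancestors to one contributes
  \<open>k c\<^bsup>k-1\<^esup>\<close> by \<open>iid_sum_asymptotics\<close>. It remains to compare the geometric probabilities
  \<open>\<eta>\<^sub>n q\<^sub>n (1 - q\<^sub>n)\<^bsup>a-1\<^esup>\<close> for \<open>n\<close> and \<open>n + h\<close>: the prefactors have the quotient
  \<open>\<mu>\<^bsup>-h\<^esup> (D\<^bsub>n+h\<^esub> / D\<^sub>n)\<^sup>2\<close>, and the quotient of the powers tends to one.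
\<close>

lemma gw_process_ratio:
  fixes a :: "nat \<Rightarrow> nat"
  assumes \<eta>q: "0 < \<eta>" "\<eta> < 1" "0 < q" "q < 1" and \<mu>: "\<mu> = \<eta> / q" and a: "\<And>n. n \<ge> 1 \<Longrightarrow> a n \<ge> 1"
    and sub: "\<mu> < 1 \<Longrightarrow> (\<lambda>n. real (a n) * \<mu> ^ n) \<longlonglongrightarrow> 0"
    and crit: "\<mu> = 1 \<Longrightarrow> (\<lambda>n. real (a n) * real n powi (-2)) \<longlonglongrightarrow> 0"
    and super: "\<mu> > 1 \<Longrightarrow> (\<lambda>n. real (a n) * \<mu> powi (- int n)) \<longlonglongrightarrow> 0"
  defines "c \<equiv> min 1 ((1 - \<eta>) / (1 - q))"
  shows "(\<lambda>n. pmf (gw_process (geo_offspring \<eta> q) n k) (a (n + h)) /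
      pmf (gw_process (geo_offspring \<eta> q) (n + h) 1) (a (n + h)))
    \<longlonglongrightarrow> real k * c ^ (k - 1) / min \<mu> (1 / \<mu>) ^ h"
proof -
  let ?D = "gen_denom \<eta> q"
  define E Q where "E n = \<mu> ^ n / ?D n" and "Q n = 1 / ?D n" for n
  note D_asymp = gen_denom_asymptotics[OF \<eta>q \<mu> sub crit super]
  have \<mu>_pos: "\<mu> > 0" using \<mu> \<eta>q by simp
  have D: "?D n > 1" "?D n > \<mu> ^ n" if "n \<ge> 1" for n
    using gen_denom_ge_1(2)[OF \<eta>q that] power_less_gen_denom(2)[OF \<eta>q that] \<mu> by auto
  have EQ: "0 < E n" "E n < 1" "0 < Q n" "Q n < 1" if "n \<ge> 1" for n
    using D[OF that] \<mu>_pos by (auto simp: E_def Q_def)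
  have process: "gw_process (geo_offspring \<eta> q) n k = iid_sum (geo_offspring (E n) (Q n)) k" if "n \<ge> 1" for n k
    using gw_process_geo_offspring[OF \<eta>q that] by (simp add: E_def Q_def \<mu>)
  have one: "iid_sum p 1 = p" for p by (simp add: map_pmf_def bind_return_pmf bind_return_pmf')
  have numerator: "(\<lambda>n. pmf (iid_sum (geo_offspring (E n) (Q n)) k) (a (n + h)) / pmf (geo_offspring (E n) (Q n)) (a (n + h)))
      \<longlonglongrightarrow> real k * c ^ (k - 1)"
  proof (rule iid_sum_asymptotics)
    show "\<forall>\<^sub>F n in sequentially. 0 < E n \<and> E n < 1 \<and> 0 < Q n \<and> Q n < 1 \<and> a (n + h) \<ge> 1"
      using eventually_ge_at_top[of 1] by eventually_elim (use a in \<open>simp add: EQ\<close>)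
    show "E \<longlonglongrightarrow> 1 - c" unfolding E_def c_def by (rule D_asymp(1))
    have "\<forall>\<^sub>F n in sequentially. real (a (n + h)) * (\<mu> ^ n / (?D n * (?D n - 1))) =
        E n * Q n * real (a (n + h)) / (1 - Q n)"
      using eventually_ge_at_top[of 1]
    proof eventually_elim
      case (elim n)
      then show ?case using D(1)[OF elim] by (simp add: E_def Q_def divide_simps)
    qed
    from Lim_transform_eventually[OF D_asymp(3) this]
    show "(\<lambda>n. E n * Q n * real (a (n + h)) / (1 - Q n)) \<longlonglongrightarrow> 0" .
  qed
  have prefactor: "(\<lambda>n. E n * Q n / (E (n + h) * Q (n + h))) \<longlonglongrightarrow> 1 / min \<mu> (1 / \<mu>) ^ h"
  proof -
    have "(\<lambda>n. (?D (n + h) / ?D n) ^ 2 / \<mu> ^ h) \<longlonglongrightarrow> (max 1 \<mu> ^ h) ^ 2 / \<mu> ^ h"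
      by (intro tendsto_intros D_asymp(2)) (use \<mu>_pos in auto)
    moreover have "(max 1 \<mu> ^ h) ^ 2 / \<mu> ^ h = 1 / min \<mu> (1 / \<mu>) ^ h"
    proof (cases "\<mu> \<le> 1")
      case True
      then have "min \<mu> (1 / \<mu>) = \<mu>" "max 1 \<mu> = 1"
        using \<mu>_pos by (auto simp: min_def field_simps intro: order_trans[of _ 1] mult_le_one)
      then show ?thesis by simp
    next
      case False
      then have "1 \<le> \<mu> * \<mu>" by (intro mult_ge1_I) auto
      then have "min \<mu> (1 / \<mu>) = 1 / \<mu>" "max 1 \<mu> = \<mu>"
        using False by (auto simp: min_def field_simps)
      then show ?thesis using \<mu>_pos by (simp add: power_divide power2_eq_square)
    qed
    moreover have "(?D (n + h) / ?D n) ^ 2 / \<mu> ^ h = E n * Q n / (E (n + h) * Q (n + h))" for n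
      using \<mu>_pos gen_denom_ge_1(1)[OF \<eta>q, of n] gen_denom_ge_1(1)[OF \<eta>q, of "n + h"]
      by (simp add: E_def Q_def power_add power2_eq_square)
    ultimately show ?thesis by simp
  qed
  have power: "(\<lambda>n. ((1 - Q n) / (1 - Q (n + h))) ^ (a (n + h) - 1)) \<longlonglongrightarrow> 1"
  proof (rule tendsto_sandwich)
    \<comment> \<open>The base is \<open>1 - y\<close> with \<open>0 \<le> y \<le> x n\<close>, so by Bernoulli's inequality the power is at least
      \<open>1 - a (n + h) * x n\<close>, which tends to one.\<close>
    define x where "x n = (?D h - 1) * (\<mu> ^ n / (?D n * (?D n - 1)))" for n
    have bounds: "1 - real (a (n + h)) * x n \<le> ((1 - Q n) / (1 - Q (n + h))) ^ (a (n + h) - 1)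
        \<and> ((1 - Q n) / (1 - Q (n + h))) ^ (a (n + h) - 1) \<le> 1" if n: "n \<ge> 1" for n
    proof -
      define y where "y = 1 - (1 - Q n) / (1 - Q (n + h))"
      have Dn: "?D n > 1" and Dh: "?D h \<ge> 1" using D n gen_denom_ge_1(1)[OF \<eta>q] by auto
      have diff: "?D (n + h) - ?D n = (?D h - 1) * \<mu> ^ n"
        unfolding \<mu> by (rule gen_denom_diff)
      then have ge: "?D (n + h) \<ge> ?D n"
        using Dh \<mu>_pos by (smt (verit) mult_nonneg_nonneg zero_le_power)
      have y: "y = (?D (n + h) - ?D n) / (?D n * (?D (n + h) - 1))"
        using Dn ge by (simp add: y_def Q_def divide_simps) (simp add: algebra_simps)
      have "y \<ge> 0" unfolding y using Dn ge by simp
      have "y \<le> (?D (n + h) - ?D n) / (?D n * (?D n - 1))"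
        unfolding y using Dn ge by (intro divide_left_mono mult_left_mono mult_pos_pos) auto
      also have "\<dots> = x n" unfolding diff x_def by simp
      finally have "y \<le> x n" .
      have "y \<le> 1"
        using EQ(4)[of n] EQ(4)[of "n + h"] n by (simp add: y_def)
      have "1 - real (a (n + h)) * x n \<le> 1 + real (a (n + h) - 1) * (- y)"
        using \<open>y \<ge> 0\<close> \<open>y \<le> x n\<close> mult_mono[of "real (a (n + h) - 1)" "real (a (n + h))" y "x n"] by simp
      also have "\<dots> \<le> (1 + (- y)) ^ (a (n + h) - 1)"
        using \<open>y \<le> 1\<close> by (intro Bernoulli_inequality) simp
      finally show ?thesis
        using \<open>y \<ge> 0\<close> \<open>y \<le> 1\<close> power_le_one[of "1 - y" "a (n + h) - 1"] by (simp add: y_def)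
    qed
    show "\<forall>\<^sub>F n in sequentially. 1 - real (a (n + h)) * x n \<le> ((1 - Q n) / (1 - Q (n + h))) ^ (a (n + h) - 1)"
      "\<forall>\<^sub>F n in sequentially. ((1 - Q n) / (1 - Q (n + h))) ^ (a (n + h) - 1) \<le> 1"
      using eventually_ge_at_top[of 1] by (eventually_elim, use bounds in blast)+
    have "(\<lambda>n. 1 - (?D h - 1) * (real (a (n + h)) * (\<mu> ^ n / (?D n * (?D n - 1))))) \<longlonglongrightarrow> 1 - (?D h - 1) * 0"
      by (intro tendsto_intros D_asymp(3))
    then show "(\<lambda>n. 1 - real (a (n + h)) * x n) \<longlonglongrightarrow> 1"
      by (simp add: x_def mult_ac)
  qed simp
  have "(\<lambda>n. pmf (iid_sum (geo_offspring (E n) (Q n)) k) (a (n + h)) / pmf (geo_offspring (E n) (Q n)) (a (n + h)) *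
      (E n * Q n / (E (n + h) * Q (n + h)) * ((1 - Q n) / (1 - Q (n + h))) ^ (a (n + h) - 1)))
      \<longlonglongrightarrow> real k * c ^ (k - 1) * (1 / min \<mu> (1 / \<mu>) ^ h * 1)"
    by (intro tendsto_mult numerator prefactor power)
  moreover have "\<forall>\<^sub>F n in sequentially.
      pmf (iid_sum (geo_offspring (E n) (Q n)) k) (a (n + h)) / pmf (geo_offspring (E n) (Q n)) (a (n + h)) *
      (E n * Q n / (E (n + h) * Q (n + h)) * ((1 - Q n) / (1 - Q (n + h))) ^ (a (n + h) - 1)) =
      pmf (gw_process (geo_offspring \<eta> q) n k) (a (n + h)) /
      pmf (gw_process (geo_offspring \<eta> q) (n + h) 1) (a (n + h))"
    using eventually_ge_at_top[of 1]
  proof eventually_elim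
    case (elim n)
    have a1: "a (n + h) \<ge> 1" using elim by (intro a) simp
    have geo: "pmf (geo_offspring (E m) (Q m)) (a (n + h)) = E m * Q m * (1 - Q m) ^ (a (n + h) - 1)" if "m \<ge> 1" for m
      using EQ[OF that] a1 by (simp add: pmf_geo_offspring)
    have nh: "n + h \<ge> 1" using elim by simp
    show ?case
      unfolding process[OF elim] process[OF nh] one geo[OF elim] geo[OF nh]
      using EQ[OF elim] by (simp add: power_divide)
  qed
  ultimately show ?thesis by (simp add: Lim_transform_eventually)
qed

section \<open>Comparing the conditioned tree with the Kesten tree\<close>

lemma prod_power_int:
  fixes c :: real
  assumes "finite A" "c \<noteq> 0"
  shows "(\<Prod>x\<in>A. c powi f x) = c powi (\<Sum>x\<in>A. f x)"
  using assms by (induction A rule: finite_induct) (simp_all add: power_int_add)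

text \<open>
  Each generation contributes \<open>\<Sum> (k\<^sub>u - 1)\<close>, the increase of the population, to the exponent of \<open>c\<close>.
  The sum telescopes to \<open>z\<^sub>h(t) - 1\<close>.
\<close>

lemma tree_weight_tilted:
  assumes "c \<noteq> 0" and p': "\<And>n. pmf p' n = c powi (int n - 1) * pmf p n" and "t \<in> trees_upto h"
  shows "tree_weight p' h t = c powi (int (gen_size h t) - 1) * tree_weight p h t"
  using assms(3)
proof (induction h arbitrary: t)
  case 0
  then show ?case by (simp add: trees_upto_0 tree_weight_def gen_size_eq_card_level level_def Collect_conv_if)
next
  case (Suc h)
  have fb: "t \<in> finite_branching_trees" using Suc.prems trees_upto_subset by blast
  have fin: "finite (level h t)" by (rule finite_level[OF fb])
  let ?k = "num_children t"
  have "(\<Prod>u\<in>level h t. pmf p' (?k u)) = c powi (\<Sum>u\<in>level h t. int (?k u) - 1) * (\<Prod>u\<in>level h t. pmf p (?k u))"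
    by (simp add: p' prod.distrib prod_power_int[OF fin assms(1)])
  also have "(\<Sum>u\<in>level h t. int (?k u) - 1) = int (gen_size (Suc h) t) - int (gen_size h t)"
    by (simp add: sum_subtractf card_level_Suc[OF fb] gen_size_eq_card_level[of h t])
  finally have level: "(\<Prod>u\<in>level h t. pmf p' (?k u)) =
      c powi (int (gen_size (Suc h) t) - int (gen_size h t)) * (\<Prod>u\<in>level h t. pmf p (?k u))" .
  have "c powi (int (gen_size (Suc h) t) - 1) =
      c powi (int (gen_size h t) - 1) * c powi (int (gen_size (Suc h) t) - int (gen_size h t))"
    using assms(1) by (simp flip: power_int_add)
  then show ?case
    using Suc.IH[OF truncate_in_trees_upto(1)[OF fb]]
    by (simp add: tree_weight_Suc[OF fb] level gen_size_truncate)
qed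

lemma geo_offspring_mean:
  assumes "0 < \<eta>" "\<eta> < 1" "0 < q" "q < 1"
  shows "integrable (measure_pmf (geo_offspring \<eta> q)) real"
    and "measure_pmf.expectation (geo_offspring \<eta> q) real = \<eta> / q"
proof -
  let ?f = "\<lambda>k. pmf (geo_offspring \<eta> q) k * real k"
  have "(\<lambda>k. \<eta> * q / (1 - q) * ((1 - q) ^ k * of_nat k)) sums (\<eta> * q / (1 - q) * ((1 - q) / (1 - (1 - q))\<^sup>2))"
    using assms by (intro sums_mult geometric_sums_times_n) auto
  moreover have "(\<lambda>k. \<eta> * q / (1 - q) * ((1 - q) ^ k * of_nat k)) = ?f"
  proof
    fix k show "\<eta> * q / (1 - q) * ((1 - q) ^ k * of_nat k) = ?f k"
      using assms by (cases k) (simp_all add: pmf_geo_offspring)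
  qed
  ultimately have sums: "?f sums (\<eta> / q)"
    using assms by (simp add: power2_eq_square)
  have "integrable (count_space UNIV) ?f"
    using sums by (simp add: integrable_count_space_nat_iff sums_iff)
  then show "integrable (measure_pmf (geo_offspring \<eta> q)) real"
    by (simp add: measure_pmf_eq_density integrable_density)
  have "measure_pmf.expectation (geo_offspring \<eta> q) real = integral\<^sup>L (count_space UNIV) ?f"
    by (simp add: measure_pmf_eq_density integral_density)
  also have "\<dots> = \<eta> / q"
    using sums_integral_count_space_nat[OF \<open>integrable (count_space UNIV) ?f\<close>] sums by (rule sums_unique2)
  finally show "measure_pmf.expectation (geo_offspring \<eta> q) real = \<eta> / q" .
qed

text \<open>
  In the supercritical case the tilting exchanges the two parameters; this is the law of the tree conditioned on extinction.
\<close>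

lemma tilted_geo_offspring:
  assumes "0 < \<eta>" "\<eta> < 1" "0 < q" "q < 1"
  shows "tilted (min 1 ((1 - \<eta>) / (1 - q))) (geo_offspring \<eta> q) =
    (if \<eta> \<le> q then geo_offspring \<eta> q else geo_offspring q \<eta>)"
proof (rule pmf_eqI)
  fix k
  show "pmf (tilted (min 1 ((1 - \<eta>) / (1 - q))) (geo_offspring \<eta> q)) k =
    pmf (if \<eta> \<le> q then geo_offspring \<eta> q else geo_offspring q \<eta>) k"
  proof (cases "\<eta> \<le> q")
    case True
    then have "min 1 ((1 - \<eta>) / (1 - q)) = 1" using assms by simp
    then show ?thesis
      using True pmf_tilted_geo_offspring[OF assms refl, of k] by simp
  next
    case False
    then have "min 1 ((1 - \<eta>) / (1 - q)) = (1 - \<eta>) / (1 - q)" using assms by simp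
    then show ?thesis
      using False assms pmf_tilted_geo_offspring[OF assms refl, of k]
      by (cases k) (simp_all add: pmf_geo_offspring power_int_minus power_divide)
  qed
qed

lemma tilted_geo_offspring_mean:
  assumes "0 < \<eta>" "\<eta> < 1" "0 < q" "q < 1"
  defines "p \<equiv> tilted (min 1 ((1 - \<eta>) / (1 - q))) (geo_offspring \<eta> q)"
  shows "integrable (measure_pmf p) real"
    and "measure_pmf.expectation p real = min (\<eta> / q) (1 / (\<eta> / q))"
proof -
  have p: "p = (if \<eta> \<le> q then geo_offspring \<eta> q else geo_offspring q \<eta>)"
    unfolding p_def by (rule tilted_geo_offspring[OF assms(1-4)])
  then show "integrable (measure_pmf p) real"
    using assms(1-4) by (simp add: geo_offspring_mean)
  show "measure_pmf.expectation p real = min (\<eta> / q) (1 / (\<eta> / q))"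
  proof (cases "\<eta> \<le> q")
    case True
    then have "\<eta> / q \<le> 1" "1 \<le> 1 / (\<eta> / q)" using assms(1-4) by simp_all
    then have "min (\<eta> / q) (1 / (\<eta> / q)) = \<eta> / q" by (intro min_absorb1) (rule order_trans)
    then show ?thesis
      using True assms(1-4) unfolding p by (simp add: geo_offspring_mean)
  next
    case False
    then have "\<eta> / q > 1" "1 / (\<eta> / q) < 1" using assms(1-4) by simp_all
    then have "min (\<eta> / q) (1 / (\<eta> / q)) = 1 / (\<eta> / q)" by simp
    then show ?thesis
      using False assms(1-4) unfolding p by (simp add: geo_offspring_mean)
  qed
qed

lemma galton_watson_gen_size:
  assumes gw: "galton_watson_tree M p \<tau>"
  shows "\<P>(\<omega> in M. gen_size n (\<tau> \<omega>) = a) = pmf (gw_process p n 1) a"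
proof -
  have "truncate 0 (\<tau> \<omega>) = {[]}" if "\<omega> \<in> space M" for \<omega>
    using gw that truncate_in_trees_upto(1)[of "\<tau> \<omega>" 0] by (simp add: galton_watson_tree_def trees_upto_0)
  then have "{\<omega> \<in> space M. gen_size n (\<tau> \<omega>) = a} = {\<omega> \<in> space M. truncate 0 (\<tau> \<omega>) = {[]} \<and> gen_size (0 + n) (\<tau> \<omega>) = a}"
    by auto
  then have "\<P>(\<omega> in M. gen_size n (\<tau> \<omega>) = a) = \<P>(\<omega> in M. truncate 0 (\<tau> \<omega>) = {[]} \<and> gen_size (0 + n) (\<tau> \<omega>) = a)"
    by simp
  also have "\<dots> = tree_weight p 0 {[]} * pmf (gw_process p n (gen_size 0 {[]})) a"
    by (rule galton_watson_branching[OF gw]) (simp add: trees_upto_0)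
  also have "gen_size 0 {[]} = 1" by (simp add: gen_size_def Collect_conv_if)
  finally show ?thesis by (simp add: tree_weight_def)
qed

text \<open>
  The conditional law is a quotient of two probabilities, and both are given by the branching property:
  one from \<open>t\<close> at height \<open>h\<close>, the other from the root.
\<close>

lemma conditioned_truncate_prob:
  assumes gw: "galton_watson_tree M p \<tau>" and X: "random_tree N X"
    and law: "\<And>B. B \<in> sets tree_borel \<Longrightarrow>
      \<P>(\<omega> in N. X \<omega> \<in> B) = \<P>(\<omega> in M. \<tau> \<omega> \<in> B \<bar> gen_size (h + m) (\<tau> \<omega>) = a)"
    and t: "t \<in> trees_upto h"
  shows "\<P>(\<omega> in N. truncate h (X \<omega>) = t) =
    tree_weight p h t * (pmf (gw_process p m (gen_size h t)) a / pmf (gw_process p (h + m) 1) a)"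
proof -
  let ?B = "{s \<in> all_trees. truncate h s = t}"
  have "{s \<in> space tree_borel. truncate h s = t} \<in> sets tree_borel"
    by (rule truncate_eq_sets[of tree_borel "\<lambda>s. s"]) (simp add: space_tree_borel sets_tree_borel_mem)
  then have B: "?B \<in> sets tree_borel" by (simp add: space_tree_borel)
  have X_tree: "X \<omega> \<in> all_trees" if "\<omega> \<in> space N" for \<omega>
    using X that measurable_space[of X N tree_borel] by (auto simp: random_tree_def space_tree_borel)
  have \<tau>_tree: "\<tau> \<omega> \<in> all_trees" if "\<omega> \<in> space M" for \<omega>
    using gw that trees_upto_subset(2) by (auto simp: galton_watson_tree_def)
  have "{\<omega> \<in> space N. truncate h (X \<omega>) = t} = {\<omega> \<in> space N. X \<omega> \<in> ?B}"
    using X_tree by auto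
  then have "\<P>(\<omega> in N. truncate h (X \<omega>) = t) = \<P>(\<omega> in N. X \<omega> \<in> ?B)" by simp
  also have "\<dots> = \<P>(\<omega> in M. \<tau> \<omega> \<in> ?B \<and> gen_size (h + m) (\<tau> \<omega>) = a) / \<P>(\<omega> in M. gen_size (h + m) (\<tau> \<omega>) = a)"
    unfolding law[OF B] cond_prob_def ..
  also have "{\<omega> \<in> space M. \<tau> \<omega> \<in> ?B \<and> gen_size (h + m) (\<tau> \<omega>) = a} =
      {\<omega> \<in> space M. truncate h (\<tau> \<omega>) = t \<and> gen_size (h + m) (\<tau> \<omega>) = a}"
    using \<tau>_tree by auto
  finally show ?thesis
    by (simp add: galton_watson_branching[OF gw t] galton_watson_gen_size[OF gw])
qed

theorem proposition4p2:
  fixes \<eta> q \<mu> \<kappa> \<cc> :: real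
    and a :: "nat \<Rightarrow> nat"
    and M :: "'a measure" and \<tau> :: "'a \<Rightarrow> nat list set"
    and N :: "nat \<Rightarrow> 'b measure" and \<tau>s :: "nat \<Rightarrow> 'b \<Rightarrow> nat list set"
    and K :: "'c measure" and \<tau>0 :: "'c \<Rightarrow> nat list set"
  assumes "0 < \<eta>" "\<eta> < 1" "0 < q" "q < 1"
    and "\<mu> = \<eta> / q" and "\<kappa> = (1 - \<eta>) / (1 - q)" and "\<cc> = min 1 \<kappa>"
    and "\<And>n. n \<ge> 1 \<Longrightarrow> a n \<ge> 1"
    and "galton_watson_tree M (geo_offspring \<eta> q) \<tau>"
    and "\<And>n. n \<ge> 1 \<Longrightarrow> random_tree (N n) (\<tau>s n)"
    and "\<And>n B. n \<ge> 1 \<Longrightarrow> B \<in> sets tree_borel \<Longrightarrow>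
           \<P>(\<omega> in N n. \<tau>s n \<omega> \<in> B) = \<P>(\<omega> in M. \<tau> \<omega> \<in> B \<bar> gen_size n (\<tau> \<omega>) = a n)"
    and "\<mu> < 1 \<Longrightarrow> (\<lambda>n. real (a n) * \<mu> ^ n) \<longlonglongrightarrow> 0"
    and "\<mu> = 1 \<Longrightarrow> (\<lambda>n. real (a n) * real n powi (-2)) \<longlonglongrightarrow> 0"
    and "\<mu> > 1 \<Longrightarrow> (\<lambda>n. real (a n) * \<mu> powi (- int n)) \<longlonglongrightarrow> 0"
    and "kesten_tree K (tilted \<cc> (geo_offspring \<eta> q)) \<tau>0"
  shows "conv_in_distribution tree_topology N \<tau>s K \<tau>0"
proof -
  let ?G = "geo_offspring \<eta> q" and ?G' = "tilted \<cc> (geo_offspring \<eta> q)" and ?m = "min \<mu> (1 / \<mu>)"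
  note \<eta>q = assms(1-4)
  have \<cc>: "\<cc> = min 1 ((1 - \<eta>) / (1 - q))" and "\<cc> > 0"
    using assms(1-7) by auto
  have mean: "integrable (measure_pmf ?G') real" "measure_pmf.expectation ?G' real = ?m" and "?m > 0"
    using tilted_geo_offspring_mean[OF \<eta>q] \<eta>q by (simp_all add: \<cc> assms(5))
  obtain T where T: "multitype_GW_tree K Special (kesten_offspring ?G') T"
      and \<tau>0: "\<And>\<omega>. \<omega> \<in> space K \<Longrightarrow> \<tau>0 \<omega> = dom (T \<omega>)"
    using assms(15) by (auto simp: kesten_tree_def)
  show ?thesis
  proof (rule conv_in_distribution_truncate)
    show "random_tree (N n) (\<tau>s n)" if "n \<ge> 1" for n by (rule assms(10)[OF that])
    show "prob_space K" using T by (simp add: multitype_GW_tree_def)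
    show "\<tau>0 \<omega> \<in> finite_branching_trees" if "\<omega> \<in> space K" for \<omega>
      using T that by (simp add: multitype_GW_tree_def \<tau>0)
    show "{\<omega> \<in> space K. u \<in> \<tau>0 \<omega>} \<in> sets K" for u
    proof -
      have [measurable]: "(\<lambda>\<omega>. T \<omega> u) \<in> measurable K (count_space UNIV)"
        using T by (simp add: multitype_GW_tree_def)
      have "{\<omega> \<in> space K. u \<in> \<tau>0 \<omega>} = {\<omega> \<in> space K. T \<omega> u \<noteq> None}"
        using \<tau>0 by (auto simp: domIff)
      also have "\<dots> \<in> sets K" by measurable
      finally show ?thesis .
    qed
    fix h t assume t: "t \<in> trees_upto h"
    let ?k = "gen_size h t"
    have "(\<lambda>n. tree_weight ?G h t * (pmf (gw_process ?G n ?k) (a (n + h)) / pmf (gw_process ?G (n + h) 1) (a (n + h))))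
        \<longlonglongrightarrow> tree_weight ?G h t * (real ?k * \<cc> ^ (?k - 1) / ?m ^ h)"
      unfolding \<cc> by (intro tendsto_mult tendsto_const gw_process_ratio[OF \<eta>q assms(5,8,12-14)])
    moreover have "\<forall>\<^sub>F n in sequentially.
        tree_weight ?G h t * (pmf (gw_process ?G n ?k) (a (n + h)) / pmf (gw_process ?G (n + h) 1) (a (n + h))) =
        \<P>(\<omega> in N (n + h). truncate h (\<tau>s (n + h) \<omega>) = t)"
      using eventually_ge_at_top[of 1]
    proof eventually_elim
      case (elim n)
      then have "n + h \<ge> 1" by simp
      then show ?case
        using conditioned_truncate_prob[OF assms(9) assms(10) _ t, of "n + h" n "a (n + h)"] assms(11)
        by (simp add: add.commute)
    qed
    ultimately have "(\<lambda>n. \<P>(\<omega> in N (n + h). truncate h (\<tau>s (n + h) \<omega>) = t))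
        \<longlonglongrightarrow> tree_weight ?G h t * (real ?k * \<cc> ^ (?k - 1) / ?m ^ h)"
      by (rule Lim_transform_eventually)
    then have "(\<lambda>n. \<P>(\<omega> in N n. truncate h (\<tau>s n \<omega>) = t))
        \<longlonglongrightarrow> tree_weight ?G h t * (real ?k * \<cc> ^ (?k - 1) / ?m ^ h)"
      by (rule LIMSEQ_offset)
    moreover have "{\<omega> \<in> space K. truncate h (\<tau>0 \<omega>) = t} = {\<omega> \<in> space K. truncate h (dom (T \<omega>)) = t}"
      using \<tau>0 by auto
    then have "\<P>(\<omega> in K. truncate h (\<tau>0 \<omega>) = t) = real ?k * tree_weight ?G' h t / ?m ^ h"
      using kesten_truncate_prob[OF T mean(1) _ t] \<open>?m > 0\<close> by (simp add: mean(2))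
    moreover have "real ?k * tree_weight ?G' h t = tree_weight ?G h t * (real ?k * \<cc> ^ (?k - 1))"
    proof (cases "?k = 0")
      case False
      have "tree_weight ?G' h t = \<cc> powi (int ?k - 1) * tree_weight ?G h t"
        by (rule tree_weight_tilted[OF _ pmf_tilted_geo_offspring[OF \<eta>q \<cc>] t]) (use \<open>\<cc> > 0\<close> in simp)
      also have "int ?k - 1 = int (?k - 1)" using False by (simp add: of_nat_diff)
      finally show ?thesis by (simp only: power_int_of_nat mult_ac)
    qed simp
    ultimately show "(\<lambda>n. \<P>(\<omega> in N n. truncate h (\<tau>s n \<omega>) = t)) \<longlonglongrightarrow> \<P>(\<omega> in K. truncate h (\<tau>0 \<omega>) = t)"
      by simp
  qed
qed

end
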